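(* Let $0<\beta<1$. Then, for all $q(\cdot)\in\mathscr{B}(\mathbb{R}^n)$, $\dot{\Lambda}_{\beta}^{+}(\mathbb{R}^n)=\dot{\Lambda}_{\beta,q(\cdot)}^{\sharp}(\mathbb{R}^n)$. Furthermore, for each such $q(\cdot)$ there exist positive constants $C_1$ and $C_2$ such that, for all $b\in\dot{\Lambda}_{\beta}^{+}(\mathbb{R}^n)$, $$C_1\|b\|_{\dot{\Lambda}_{\beta}}\le\|b\|_{\dot{\Lambda}_{\beta,q(\cdot)}^{\sharp}}\le C_2\|b\|_{\dot{\Lambda}_{\beta}}.$$
   Context: Functions are real-valued and identified when equal almost everywhere; in particular $b\in\dot{\Lambda}_\beta(\mathbb{R}^n)$ means that $b$ agrees a.e. with a function satisfying the condition below, and $b\ge0$ is understood a.e. A cube $Q\subset\mathbb{R}^n$ always has sides parallel to the coordinate axes; $|Q|$ is its Lebesgue measure, $\chi_Q$ its characteristic function, and $f_Q=|Q|^{-1}\int_Q f(x)\,dx$ for $f\in L^1_{\rm loc}(\mathbb{R}^n)$. Lipschitz space: for $0<\beta<1$, $b\in\dot{\Lambda}_{\beta}(\mathbb{R}^n)$ if there is a constant $C$ with $|b(x)-b(y)|\le C|x-y|^{\beta}$ for all $x,y\in\mathbb{R}^n$; the smallest such $C$ is denoted $\|b\|_{\dot{\Lambda}_{\beta}}$. $\dot{\Lambda}_{\beta}^{+}(\mathbb{R}^n)=\{b: 0\le b\in\dot{\Lambda}_{\beta}(\mathbb{R}^n)\}$ is the set of nonnegative Lipschitz functions. Hardy-Littlewood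 maximal function: $M(f)(x)=\sup_{Q\ni x}\frac1{|Q|}\int_Q|f(y)|\,dy$. Sharp maximal function: $M^{\sharp}(f)(x)=\sup_{Q\ni x}\frac1{|Q|}\int_Q|f(y)-f_Q|\,dy$. Both suprema are over all cubes $Q\subset\mathbb{R}^n$ containing $x$. Variable exponent Lebesgue space: for measurable $p(\cdot):\mathbb{R}^n\to[1,\infty)$, $L^{p(\cdot)}(\mathbb{R}^n)$ is the set of measurable $f$ with $\int_{\mathbb{R}^n}(|f(x)|/\lambda)^{p(x)}dx<\infty$ for some $\lambda>0$, with norm $\|f\|_{L^{p(\cdot)}(\mathbb{R}^n)}=\inf\{\lambda>0:\int_{\mathbb{R}^n}(|f(x)|/\lambda)^{p(x)}dx\le1\}$ (equal to $\infty$ if $f\notin L^{p(\cdot)}(\mathbb{R}^n)$). $\mathscr{P}(\mathbb{R}^n)$ is the set of measurable $p(\cdot):\mathbb{R}^n\to[1,\infty)$ with $1<\operatorname{ess\,inf}_{x}p(x)$ and $\operatorname{ess\,sup}_{x}p(x)<\infty$. $\mathscr{B}(\mathbb{R}^n)$ is the set of $p(\cdot)\in\mathscr{P}(\mathbb{R}^n)$ such that $M$ is bounded on $L^{p(\cdot)}(\mathbb{R}^n)$. For $0<\beta<1$ and $q(\cdot)\in\mathscr{B}(\mathbb{R}^n)$, $\dot{\Lambda}_{\beta,q(\cdot)}^{\sharp}(\mathbb{R}^n)$ is the set of $b\in L^1_{\rm loc}(\mathbb{R}^n)$ with $$\|b\|_{\dot{\Lambda}_{\beta,q(\cdot)}^{\sharp}}=\sup_{Q}\frac1{|Q|^{\beta/n}}\frac{\|(b-2M^{\sharp}(b\chi_Q))\chi_Q\|_{L^{q(\cdot)}(\mathbb{R}^n)}}{\|\chi_Q\|_{L^{q(\cdot)}(\mathbb{R}^n)}}<\infty,$$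 the supremum over all cubes $Q\subset\mathbb{R}^n$. *)

theory Defs
  imports "HOL-Analysis.Analysis" "HOL-Probability.Essential_Supremum"
begin

text \<open>Cubes are taken closed and nondegenerate.\<close>

definition cubes :: "(real^'n) set set" where
  "cubes = {cbox a (a + vec l) | a l. l > 0}"

definition L1_loc :: "(real^'n \<Rightarrow> real) set" where
  "L1_loc = {f. f \<in> borel_measurable lebesgue \<and> (\<forall>K. compact K \<longrightarrow> f absolutely_integrable_on K)}"

definition mean :: "(real^'n) set \<Rightarrow> (real^'n \<Rightarrow> real) \<Rightarrow> real" where
  "mean Q f = (1 / measure lebesgue Q) * (LINT y:Q|lebesgue. f y)"


subsection \<open>Lipschitz spaces\<close>

text \<open>Spaces of functions modulo a.e. equality are represented by sets of functions that are
  closed under a.e. equality, so a Lipschitz constant is a constant for some representative.\<close>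

definition lipschitz_const :: "real \<Rightarrow> (real^'n \<Rightarrow> real) \<Rightarrow> real \<Rightarrow> bool" where
  "lipschitz_const \<beta> b C \<longleftrightarrow>
     (\<exists>g. (AE x in lebesgue. b x = g x) \<and> (\<forall>x y. \<bar>g x - g y\<bar> \<le> C * norm (x - y) powr \<beta>))"

definition Lip :: "real \<Rightarrow> (real^'n \<Rightarrow> real) set" where
  "Lip \<beta> = {b. \<exists>C. lipschitz_const \<beta> b C}"

definition Lip_norm :: "real \<Rightarrow> (real^'n \<Rightarrow> real) \<Rightarrow> real" where
  "Lip_norm \<beta> b = Inf {C. lipschitz_const \<beta> b C}"

definition Lip_plus :: "real \<Rightarrow> (real^'n \<Rightarrow> real) set" where
  "Lip_plus \<beta> = {b \<in> Lip \<beta>. AE x in lebesgue. 0 \<le> b x}"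


subsection \<open>Maximal functions\<close>

definition HL_max :: "(real^'n \<Rightarrow> real) \<Rightarrow> real^'n \<Rightarrow> ennreal" where
  "HL_max f x = (SUP Q\<in>{Q \<in> cubes. x \<in> Q}.
     1 / emeasure lebesgue Q * (\<integral>\<^sup>+y\<in>Q. ennreal \<bar>f y\<bar> \<partial>lebesgue))"

definition sharp_max :: "(real^'n \<Rightarrow> real) \<Rightarrow> real^'n \<Rightarrow> ennreal" where
  "sharp_max f x = (SUP Q\<in>{Q \<in> cubes. x \<in> Q}.
     1 / emeasure lebesgue Q * (\<integral>\<^sup>+y\<in>Q. ennreal \<bar>f y - mean Q f\<bar> \<partial>lebesgue))"


subsection \<open>Variable exponent Lebesgue spaces\<close>

definition ennreal_powr :: "ennreal \<Rightarrow> real \<Rightarrow> ennreal" where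
  "ennreal_powr a r = (if a = \<infinity> then \<infinity> else ennreal (enn2real a powr r))"

text \<open>The modular and the norm accept extended real functions because maximal functions may be
  infinite; a function that is infinite on a set of positive measure has infinite norm.
  Below, \<open>Inf {} = \<infinity>\<close> in \<^typ>\<open>ennreal\<close>.\<close>

definition modular :: "(real^'n \<Rightarrow> real) \<Rightarrow> (real^'n \<Rightarrow> ereal) \<Rightarrow> ennreal" where
  "modular p f = (\<integral>\<^sup>+x. ennreal_powr (e2ennreal \<bar>f x\<bar>) (p x) \<partial>lebesgue)"

definition Lp_norm :: "(real^'n \<Rightarrow> real) \<Rightarrow> (real^'n \<Rightarrow> ereal) \<Rightarrow> ennreal" where
  "Lp_norm p f = Inf {ennreal t | t. t > 0 \<and> modular p (\<lambda>x. f x / ereal t) \<le> 1}"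

definition Lp_space :: "(real^'n \<Rightarrow> real) \<Rightarrow> (real^'n \<Rightarrow> real) set" where
  "Lp_space p = {f. f \<in> borel_measurable lebesgue \<and>
     (\<exists>t>0. modular p (\<lambda>x. ereal (f x) / ereal t) < \<infinity>)}"

text \<open>\<open>Liminf\<close> along the a.e. filter is the essential infimum, dually to \<^const>\<open>esssup\<close>.\<close>

definition exponents_P :: "(real^'n \<Rightarrow> real) set" where
  "exponents_P = {p. p \<in> borel_measurable lebesgue \<and> (\<forall>x. 1 \<le> p x) \<and>
     1 < Liminf (ae_filter lebesgue) (\<lambda>x. ereal (p x)) \<and>
     esssup lebesgue (\<lambda>x. ereal (p x)) < \<infinity>}"

definition exponents_B :: "(real^'n \<Rightarrow> real) set" where
  "exponents_B = {p \<in> exponents_P. \<exists>C::real. \<forall>f\<in>Lp_space p.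
     Lp_norm p (\<lambda>x. enn2ereal (HL_max f x)) \<le> ennreal C * Lp_norm p (\<lambda>x. ereal (f x))}"


subsection \<open>The space defined by the sharp maximal function\<close>

definition sharp_norm :: "real \<Rightarrow> (real^'n \<Rightarrow> real) \<Rightarrow> (real^'n \<Rightarrow> real) \<Rightarrow> ennreal" where
  "sharp_norm \<beta> q b = (SUP Q\<in>cubes.
     1 / ennreal (measure lebesgue Q powr (\<beta> / real CARD('n))) *
     (Lp_norm q (\<lambda>x. (ereal (b x) - 2 * enn2ereal (sharp_max (\<lambda>y. b y * indicator Q y) x))
                     * indicator Q x)
      / Lp_norm q (indicator Q)))"

definition sharp_space :: "real \<Rightarrow> (real^'n \<Rightarrow> real) \<Rightarrow> (real^'n \<Rightarrow> real) set" where
  "sharp_space \<beta> q = {b \<in> L1_loc. sharp_norm \<beta> q b < \<infinity>}"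

end

theory Submission
  imports Defs
begin

text \<open>For \<open>x \<in> Q\<close>, testing the sharp maximal function on a cube of twice the volume gives
  \<open>2 M\<^sup>\<sharp>(b \<chi>\<^sub>Q)(x) \<ge> \<bar>b\<^sub>Q\<bar>\<close>, and since \<open>M\<^sup>\<sharp>(\<chi>\<^sub>Q) \<le> 1/2\<close>, a nonnegative Lipschitz function satisfies
  \<open>2 M\<^sup>\<sharp>(b \<chi>\<^sub>Q) \<le> b\<close> up to its oscillation on \<open>Q\<close>; this is the upper bound.

  Conversely, \<open>(\<bar>b\<^sub>Q\<bar> - b)\<^sup>+ \<chi>\<^sub>Q\<close> is dominated by \<open>\<bar>b - 2 M\<^sup>\<sharp>(b \<chi>\<^sub>Q)\<bar> \<chi>\<^sub>Q\<close>, and its Hardy-Littlewood maximal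
  function is at least its mean on \<open>Q\<close>, so boundedness of \<open>M\<close> bounds this mean by a multiple of
  \<open>\<bar>Q\<bar>\<close> to the power \<open>\<beta> / n\<close>. This controls the means of both \<open>b\<^sup>-\<close> and \<open>\<bar>b - b\<^sub>Q\<bar>\<close>, so \<open>b \<ge> 0\<close> almost
  everywhere and Campanato's theorem applies.\<close>

subsection \<open>Cubes\<close>

abbreviation cube :: "real^'n \<Rightarrow> real \<Rightarrow> (real^'n) set" where
  "cube a l \<equiv> cbox a (a + vec l)"

lemma mem_cube: "x \<in> cube a l \<longleftrightarrow> (\<forall>i. a $ i \<le> x $ i \<and> x $ i \<le> a $ i + l)"
  by (simp add: mem_box_cart)

lemma mem_cubes_iff: "Q \<in> cubes \<longleftrightarrow> (\<exists>a l. Q = cube a l \<and> 0 < l)"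
  by (auto simp: cubes_def)

lemma cube_in_cubes: "0 < l \<Longrightarrow> cube a l \<in> cubes"
  by (auto simp: cubes_def)

lemma cube_subset:
  assumes "\<And>i. a $ i \<le> x $ i" "\<And>i. x $ i + s \<le> a $ i + l"
  shows "cube x s \<subseteq> cube a l"
proof
  fix y assume y: "y \<in> cube x s"
  show "y \<in> cube a l"
    unfolding mem_cube
  proof
    fix i
    have "x $ i \<le> y $ i" "y $ i \<le> x $ i + s" using y by (auto simp: mem_cube)
    with assms[of i] show "a $ i \<le> y $ i \<and> y $ i \<le> a $ i + l" by linarith
  qed
qed

lemma measure_cube:
  fixes a :: "real^'n"
  assumes "0 < l"
  shows "measure lborel (cube a l) = l ^ CARD('n)"
proof -
  have "cube a l \<noteq> {}" using assms by (auto simp: interval_eq_empty_cart)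
  then show ?thesis by (simp add: content_cbox_cart)
qed

lemma emeasure_cube:
  fixes a :: "real^'n"
  assumes "0 < l"
  shows "emeasure lborel (cube a l) = ennreal (l ^ CARD('n))"
  using measure_cube[OF assms, of a] emeasure_eq_ennreal_measure[of lborel "cube a l"]
  by (simp add: emeasure_lborel_cbox_eq)

text \<open>Comparison with the l1 norm gives the diameter bound with factor
  \<open>CARD('n)\<close>, which reappears as \<open>real CARD('n) powr \<beta>\<close> in the upper
  constant of the theorem.\<close>

lemma norm_diff_le_cube:
  fixes x y :: "real^'n"
  assumes "x \<in> cube a l" "y \<in> cube a l"
  shows "norm (x - y) \<le> real CARD('n) * l"
proof -
  have "norm (x - y) \<le> (\<Sum>i\<in>UNIV. \<bar>(x - y) $ i\<bar>)" by (rule norm_le_l1_cart)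
  also have "\<dots> \<le> (\<Sum>i\<in>(UNIV::'n set). l)"
  proof (rule sum_mono)
    fix i
    have "a $ i \<le> x $ i \<and> x $ i \<le> a $ i + l" "a $ i \<le> y $ i \<and> y $ i \<le> a $ i + l"
      using assms by (auto simp: mem_cube)
    then show "\<bar>(x - y) $ i\<bar> \<le> l" by auto
  qed
  finally show ?thesis by simp
qed

lemma measure_powr_cube:
  fixes a :: "real^'n"
  assumes "0 < l"
  shows "measure lebesgue (cube a l) powr (\<beta> / real CARD('n)) = l powr \<beta>"
  using assms by (simp add: measure_cube powr_powr flip: powr_realpow)

subsection \<open>Variable exponent norms\<close>

lemma ennreal_powr_mono: "a \<le> b \<Longrightarrow> 0 \<le> r \<Longrightarrow> ennreal_powr a r \<le> ennreal_powr b r"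
  by (auto simp: ennreal_powr_def top_unique less_top intro!: ennreal_leI powr_mono2 enn2real_mono)

lemma modular_mono_AE:
  assumes "AE x in lebesgue. \<bar>f x\<bar> \<le> \<bar>g x\<bar>" "\<And>x. 0 \<le> p x"
  shows "modular p f \<le> modular p g"
  unfolding modular_def using assms(1)
  by (intro nn_integral_mono_AE) (auto elim!: eventually_mono intro!: ennreal_powr_mono e2ennreal_mono assms(2))

lemma Lp_norm_mono_AE:
  assumes "AE x in lebesgue. \<bar>f x\<bar> \<le> \<bar>g x\<bar>" "\<And>x. 0 \<le> p x"
  shows "Lp_norm p f \<le> Lp_norm p g"
proof -
  have *: "\<bar>x / ereal t\<bar> = \<bar>x\<bar> / ereal t" if "t > 0" for x t
    using that by (cases x) auto
  have "modular p (\<lambda>x. f x / ereal t) \<le> modular p (\<lambda>x. g x / ereal t)" if "t > 0" for t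
    using assms(1)
    by (intro modular_mono_AE)
      (auto elim!: eventually_mono intro!: assms(2) ereal_divide_right_mono simp: * that)
  then show ?thesis
    unfolding Lp_norm_def by (intro Inf_superset_mono) (fastforce intro: order_trans)
qed

lemma Lp_norm_leI: "t > 0 \<Longrightarrow> modular p (\<lambda>x. f x / ereal t) \<le> 1 \<Longrightarrow> Lp_norm p f \<le> ennreal t"
  unfolding Lp_norm_def by (rule Inf_lower) auto

text \<open>Rescaling by \<open>c\<close> turns every admissible scale \<open>t\<close> for
  \<open>f\<close> into the admissible scale \<open>c * t\<close> for the multiple. Using this with
  \<open>c\<close> and with \<open>1 / c\<close> gives full homogeneity.\<close>

lemma Lp_norm_cmult_le:
  assumes "c > 0"
  shows "ennreal (1 / c) * Lp_norm p (\<lambda>x. ereal c * f x) \<le> Lp_norm p f"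
proof (subst (2) Lp_norm_def, rule Inf_greatest, clarify)
  fix t :: real assume t: "t > 0" "modular p (\<lambda>x. f x / ereal t) \<le> 1"
  have "ereal c * f x / ereal (c * t) = f x / ereal t" for x
    using assms t by (cases "f x") auto
  then have "Lp_norm p (\<lambda>x. ereal c * f x) \<le> ennreal (c * t)"
    using assms t by (intro Lp_norm_leI) auto
  then have "ennreal (1 / c) * Lp_norm p (\<lambda>x. ereal c * f x) \<le> ennreal (1 / c) * ennreal (c * t)"
    by (rule mult_left_mono) simp
  also have "\<dots> = ennreal t" using assms t by (simp flip: ennreal_mult)
  finally show "ennreal (1 / c) * Lp_norm p (\<lambda>x. ereal c * f x) \<le> ennreal t" .
qed

lemma Lp_norm_cmult:
  assumes "c > 0"
  shows "Lp_norm p (\<lambda>x. ereal c * f x) = ennreal c * Lp_norm p f"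
proof (rule antisym)
  have "ennreal c * (ennreal (1 / c) * Lp_norm p (\<lambda>x. ereal c * f x)) \<le> ennreal c * Lp_norm p f"
    by (rule mult_left_mono[OF Lp_norm_cmult_le[OF assms]]) simp
  then show "Lp_norm p (\<lambda>x. ereal c * f x) \<le> ennreal c * Lp_norm p f"
    using assms by (simp add: mult.assoc[symmetric] flip: ennreal_mult)
  have "ereal (1 / c) * (ereal c * f x) = f x" for x
    using assms by (cases "f x") auto
  then show "ennreal c * Lp_norm p f \<le> Lp_norm p (\<lambda>x. ereal c * f x)"
    using Lp_norm_cmult_le[of "1 / c" p "\<lambda>x. ereal c * f x"] assms by simp
qed

lemma modular_indicator:
  assumes "t > 0" "\<And>x. 0 < p x"
  shows "modular p (\<lambda>x. indicator Q x / ereal t) = (\<integral>\<^sup>+x. ennreal ((1 / t) powr p x) * indicator Q x \<partial>lebesgue)"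
  unfolding modular_def
proof (rule nn_integral_cong)
  fix x
  have "p x \<noteq> 0" using assms(2)[of x] by simp
  then show "ennreal_powr (e2ennreal \<bar>indicator Q x / ereal t\<bar>) (p x) = ennreal ((1 / t) powr p x) * indicator Q x"
    using assms(1) by (cases "x \<in> Q") (auto simp: ennreal_powr_def one_ereal_def zero_ereal_def)
qed

text \<open>These bounds allow the norm of an indicator to be cancelled in quotients of extended
  reals. Since \<open>p\<close> is at least 1, the number \<open>(1 / t) powr p x\<close> compares
  with \<open>1 / t\<close>, in a direction decided by whether \<open>t\<close> is above or below
  1.\<close>

lemma Lp_norm_indicator_cube:
  fixes a :: "real^'n"
  assumes "0 < l" and p: "\<And>x. 1 \<le> p x"
  shows "Lp_norm p (indicator (cube a l)) < \<infinity>" "0 < Lp_norm p (indicator (cube a l))"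
proof -
  let ?Q = "cube a l" and ?m = "l ^ CARD('n)"
  have m: "?m > 0" using assms by simp
  have p': "\<And>x. 0 < p x" using p by (meson less_le_trans zero_less_one)
  have const: "(\<integral>\<^sup>+x. ennreal c * indicator ?Q x \<partial>lebesgue) = ennreal c * ennreal ?m" for c
    using assms by (simp add: nn_integral_cmult_indicator emeasure_cube)
  \<comment> \<open>From \<open>t \<ge> 1\<close> the integrand is at most \<open>1 / t\<close>, and
    from \<open>t \<ge> ?m\<close> the resulting integral is at most 1.\<close>
  define t where "t = max 1 ?m"
  have t: "t > 0" "t \<ge> 1" "?m \<le> t" by (auto simp: t_def)
  have "modular p (\<lambda>x. indicator ?Q x / ereal t) \<le> (\<integral>\<^sup>+x. ennreal (1 / t) * indicator ?Q x \<partial>lebesgue)"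
    unfolding modular_indicator[OF t(1) p']
  proof (intro nn_integral_mono mult_right_mono ennreal_leI)
    fix x show "(1 / t) powr p x \<le> 1 / t"
      using powr_mono'[of 1 "p x" "1 / t"] p[of x] t by simp
  qed simp
  also have "\<dots> = ennreal (?m / t)" using t m by (simp add: const flip: ennreal_mult)
  also have "\<dots> \<le> 1" using t m by (simp add: ennreal_le_1)
  finally have "Lp_norm p (indicator ?Q) \<le> ennreal t"
    by (intro Lp_norm_leI t)
  then show "Lp_norm p (indicator ?Q) < \<infinity>" using le_less_trans by fastforce
  \<comment> \<open>A scale \<open>s\<close> below both 1 and the volume \<open>?m\<close> would
    have modular at least \<open>?m / s\<close>, which exceeds 1.\<close>
  have "ennreal (min 1 ?m) \<le> Lp_norm p (indicator ?Q)"
    unfolding Lp_norm_def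
  proof (rule Inf_greatest, clarify, rule ccontr)
    fix s :: real assume s: "s > 0" "modular p (\<lambda>x. indicator ?Q x / ereal s) \<le> 1"
      and "\<not> ennreal (min 1 ?m) \<le> ennreal s"
    then have sm: "s < 1" "s < ?m" using m by (auto simp: not_le ennreal_less_iff)
    have "(\<integral>\<^sup>+x. ennreal (1 / s) * indicator ?Q x \<partial>lebesgue) \<le> modular p (\<lambda>x. indicator ?Q x / ereal s)"
      unfolding modular_indicator[OF s(1) p']
    proof (intro nn_integral_mono mult_right_mono ennreal_leI)
      fix x show "1 / s \<le> (1 / s) powr p x"
        using powr_mono[of 1 "p x" "1 / s"] p[of x] s sm by simp
    qed simp
    then have "ennreal (?m / s) \<le> modular p (\<lambda>x. indicator ?Q x / ereal s)"
      using s m by (simp add: const flip: ennreal_mult)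
    from order_trans[OF this s(2)] show False using sm s by (simp add: ennreal_le_1)
  qed
  then show "0 < Lp_norm p (indicator ?Q)" using m by (auto intro: less_le_trans[rotated])
qed

subsection \<open>Campanato's theorem\<close>

lemma holder_continuous:
  fixes g :: "'a::real_normed_vector \<Rightarrow> real"
  assumes g: "\<And>x y. \<bar>g x - g y\<bar> \<le> C * norm (x - y) powr \<beta>" and "0 < \<beta>"
  shows "continuous_on UNIV g"
proof -
  have "(g \<longlongrightarrow> g x) (at x)" for x
  proof -
    have "((\<lambda>y. norm (y - x)) \<longlongrightarrow> 0) (at x)"
      by (intro tendsto_norm_zero LIM_zero tendsto_ident_at)
    then have "((\<lambda>y. norm (y - x) powr \<beta>) \<longlongrightarrow> 0) (at x)"
      by (rule tendsto_zero_powrI) (use \<open>0 < \<beta>\<close> in auto)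
    then have "((\<lambda>y. C * norm (y - x) powr \<beta>) \<longlongrightarrow> 0) (at x)"
      by (rule tendsto_mult_right_zero)
    then have "((\<lambda>y. g y - g x) \<longlongrightarrow> 0) (at x)"
      by (rule Lim_null_comparison[rotated]) (use g in auto)
    then show ?thesis by (rule LIM_zero_cancel)
  qed
  then show ?thesis by (auto simp: continuous_on_def intro: tendsto_within_subset)
qed

text \<open>The children of a bisected cube are indexed by the set \<open>S\<close> of coordinates
  in which the corner is shifted; for a given point, \<open>S\<close> collects the coordinates lying
  in the upper half. Closed children share faces, so this is a cover and not a partition.\<close>

lemma half_cubes_cover:
  "cube a l \<subseteq> (\<Union>S. cube (a + (\<chi> i. if i \<in> S then l / 2 else 0)) (l / 2))"
proof
  fix x assume x: "x \<in> cube a l"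
  let ?S = "{i. a $ i + l / 2 \<le> x $ i}"
  have "x \<in> cube (a + (\<chi> i. if i \<in> ?S then l / 2 else 0)) (l / 2)"
    unfolding mem_cube
  proof
    fix i
    have "a $ i \<le> x $ i" "x $ i \<le> a $ i + l" using x by (auto simp: mem_cube)
    then show "(a + (\<chi> i. if i \<in> ?S then l / 2 else 0)) $ i \<le> x $ i \<and>
        x $ i \<le> (a + (\<chi> i. if i \<in> ?S then l / 2 else 0)) $ i + l / 2" by auto
  qed
  then show "x \<in> (\<Union>S. cube (a + (\<chi> i. if i \<in> S then l / 2 else 0)) (l / 2))"
    by blast
qed

text \<open>Bisecting the cube \<open>k\<close> times gains a factor \<open>2 powr (- k * \<beta>)\<close> in the bound.\<close>

lemma AE_zero_if_small_on_cubes: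
  fixes h :: "real^'n \<Rightarrow> ennreal"
  assumes h[measurable]: "h \<in> borel_measurable lebesgue" and \<beta>: "0 < \<beta>" and "0 \<le> K"
    and small: "\<And>a l. 0 < l \<Longrightarrow>
      (\<integral>\<^sup>+x\<in>cube a l. h x \<partial>lebesgue) \<le> ennreal (K * l powr \<beta> * l ^ CARD('n))"
  shows "AE x in lebesgue. h x = 0"
proof -
  define q where "q = (1 / 2) powr \<beta>"
  have q: "0 < q" "q < 1" using \<beta> powr_less_mono2[of \<beta> "1/2" 1] by (auto simp: q_def)
  have step: "(\<integral>\<^sup>+x\<in>cube a l. h x \<partial>lebesgue) \<le> ennreal (K * l powr \<beta> * l ^ CARD('n) * q ^ k)"
    if "0 < l" for a l k
    using that
  proof (induction k arbitrary: a l)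
    case 0
    then show ?case using small by simp
  next
    case (Suc k)
    define Q where "Q S = cube (a + (\<chi> i. if i \<in> S then l / 2 else 0)) (l / 2)" for S
    have Q[measurable]: "Q S \<in> sets lebesgue" for S by (simp add: Q_def)
    have "(\<integral>\<^sup>+x\<in>cube a l. h x \<partial>lebesgue) \<le> (\<integral>\<^sup>+x. (\<Sum>S\<in>UNIV. h x * indicator (Q S) x) \<partial>lebesgue)"
    proof (rule nn_integral_mono)
      fix x
      show "h x * indicator (cube a l) x \<le> (\<Sum>S\<in>UNIV. h x * indicator (Q S) x)"
      proof (cases "x \<in> cube a l")
        case True
        then obtain S where "x \<in> Q S" using half_cubes_cover[of a l] by (auto simp: Q_def)
        then have "h x = h x * indicator (Q S) x" by simp
        also have "\<dots> \<le> (\<Sum>S\<in>UNIV. h x * indicator (Q S) x)" by (rule member_le_sum) auto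
        finally show ?thesis using True by simp
      qed simp
    qed
    also have "\<dots> = (\<Sum>S\<in>UNIV. (\<integral>\<^sup>+x\<in>Q S. h x \<partial>lebesgue))"
      by (rule nn_integral_sum) auto
    also have "\<dots> \<le> (\<Sum>S\<in>(UNIV::'n set set). ennreal (K * (l/2) powr \<beta> * (l/2) ^ CARD('n) * q ^ k))"
      unfolding Q_def by (intro sum_mono Suc.IH) (use Suc.prems in simp)
    \<comment> \<open>The number of children compensates exactly for the loss of volume in each, so
      that only the factor \<open>q\<close> coming from \<open>(l / 2) powr \<beta>\<close>
      survives.\<close>
    also have "\<dots> = ennreal (2 ^ CARD('n) * (K * (l/2) powr \<beta> * (l/2) ^ CARD('n) * q ^ k))"
      using Suc.prems \<open>0 \<le> K\<close> q
      by (simp add: card_UNIV_set ennreal_mult flip: ennreal_numeral ennreal_power)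
    also have "2 ^ CARD('n) * (K * (l/2) powr \<beta> * (l/2) ^ CARD('n) * q ^ k)
        = K * l powr \<beta> * l ^ CARD('n) * q ^ Suc k"
      using Suc.prems by (simp add: q_def powr_divide power_divide)
    finally show ?case .
  qed
  have zero: "(\<integral>\<^sup>+x\<in>cube a l. h x \<partial>lebesgue) = 0" if "0 < l" for a l
  proof -
    have "(\<lambda>k. K * l powr \<beta> * l ^ CARD('n) * q ^ k) \<longlonglongrightarrow> 0"
      using q by (intro tendsto_mult_right_zero LIMSEQ_power_zero) auto
    then have "(\<lambda>k. ennreal (K * l powr \<beta> * l ^ CARD('n) * q ^ k)) \<longlonglongrightarrow> ennreal 0"
      by (rule tendsto_ennrealI)
    then have "(\<integral>\<^sup>+x\<in>cube a l. h x \<partial>lebesgue) \<le> ennreal 0"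
      by (rule LIMSEQ_le_const) (use step that in auto)
    then show ?thesis by simp
  qed
  \<comment> \<open>Countably many centred cubes exhaust the space, so the null sets can be
    united.\<close>
  define C where "C m = (cube (vec (- real (Suc m))) (2 * real (Suc m)) :: (real^'n) set)" for m
  have [measurable]: "C m \<in> sets lebesgue" for m by (simp add: C_def)
  have "(\<integral>\<^sup>+x\<in>C m. h x \<partial>lebesgue) = 0" for m
    unfolding C_def by (rule zero) simp
  then have "AE x in lebesgue. h x * indicator (C m) x = 0" for m
    by (subst nn_integral_0_iff_AE[symmetric]) auto
  then have "AE x in lebesgue. \<forall>m. h x * indicator (C m) x = 0"
    by (subst AE_all_countable) blast
  then show ?thesis
  proof (rule AE_mp, intro AE_I2 impI)
    fix x :: "real^'n" assume x: "\<forall>m. h x * indicator (C m) x = 0"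
    obtain m where "norm x \<le> real m" using real_arch_simple by blast
    then have "\<bar>x $ i\<bar> \<le> real (Suc m)" for i
      using component_le_norm_cart[of x i] by simp
    then have "- real (Suc m) \<le> x $ i" "x $ i \<le> - real (Suc m) + 2 * real (Suc m)" for i
      by (smt (verit))+
    then have "x \<in> C m" by (simp add: C_def mem_cube)
    then show "h x = 0" using x[rule_format, of m] by simp
  qed
qed

text \<open>The difference is the mean of \<open>b - c\<close>, whose modulus is at most the mean of
  the modulus.\<close>

lemma mean_diff_le:
  assumes b: "set_integrable lebesgue Q b" and Q: "Q \<in> lmeasurable" "0 < measure lebesgue Q"
  shows "\<bar>mean Q b - c\<bar> \<le> (LINT y:Q|lebesgue. \<bar>b y - c\<bar>) / measure lebesgue Q"
proof -
  note c = absolutely_integrable_on_const[OF Q(1), of c]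
  have d: "set_integrable lebesgue Q (\<lambda>y. b y - c)" by (rule set_integral_diff(1)[OF b c])
  note a = set_integrable_abs[OF d]
  have I: "(LINT y:Q|lebesgue. c) = c * measure lebesgue Q"
    using Q(1) by (subst set_integral_const) (auto simp: fmeasurable_def simp del: emeasure_completion)
  have "(mean Q b - c) * measure lebesgue Q = (LINT y:Q|lebesgue. b y) - c * measure lebesgue Q"
    unfolding mean_def using Q(2) by (simp add: left_diff_distrib)
  also have "\<dots> = (LINT y:Q|lebesgue. b y - c)"
    unfolding set_integral_diff(2)[OF b c] I ..
  finally have "(mean Q b - c) * measure lebesgue Q = (LINT y:Q|lebesgue. b y - c)" .
  moreover have "(LINT y:Q|lebesgue. b y - c) \<le> (LINT y:Q|lebesgue. \<bar>b y - c\<bar>)"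
    by (rule set_integral_mono[OF d a]) auto
  moreover have "- (LINT y:Q|lebesgue. b y - c) \<le> (LINT y:Q|lebesgue. \<bar>b y - c\<bar>)"
    unfolding set_integral_uminus[OF d, symmetric]
    by (rule set_integral_mono[OF _ a]) (use set_integrable_mult_right[OF d, of "-1"] in auto)
  ultimately have "\<bar>mean Q b - c\<bar> * measure lebesgue Q \<le> (LINT y:Q|lebesgue. \<bar>b y - c\<bar>)"
    using Q by (simp add: abs_le_iff abs_mult flip: abs_of_pos)
  then show ?thesis using Q by (simp add: pos_le_divide_eq)
qed

lemma set_integral_mono_set_nonneg:
  fixes f :: "'a \<Rightarrow> real"
  assumes "set_integrable M B f" "A \<subseteq> B" "\<And>x. 0 \<le> f x"
  shows "(LINT y:A|M. f y) \<le> (LINT y:B|M. f y)"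
  unfolding set_lebesgue_integral_def
  by (rule integral_mono') (use assms in \<open>auto simp: set_integrable_def indicator_def\<close>)

text \<open>The mean of \<open>\<bar>b - mean (cube a l) b\<bar>\<close> over the small cube is at
  most its integral over the large one divided by the small volume. As \<open>l \<le> 2 * s\<close>,
  the ratio of volumes is at most \<open>2 ^ CARD('n)\<close>.\<close>

lemma mean_diff_subcube:
  fixes b :: "real^'n \<Rightarrow> real"
  assumes b: "set_integrable lebesgue (cube a l) b"
    and osc: "(LINT y:cube a l|lebesgue. \<bar>b y - mean (cube a l) b\<bar>) \<le> K * l powr \<beta> * l ^ CARD('n)"
    and s: "0 < s" "s \<le> l" "l \<le> 2 * s" and sub: "cube x s \<subseteq> cube a l"
  shows "\<bar>mean (cube x s) b - mean (cube a l) b\<bar> \<le> 2 ^ CARD('n) * K * l powr \<beta>"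
proof -
  let ?m = "mean (cube a l) b"
  have l: "0 < l" using s by simp
  have bs: "set_integrable lebesgue (cube x s) b"
    by (rule set_integrable_subset[OF b _ sub]) simp
  have d: "set_integrable lebesgue (cube a l) (\<lambda>y. \<bar>b y - ?m\<bar>)"
    by (intro set_integrable_abs set_integral_diff(1) b absolutely_integrable_on_const) simp
  have I: "0 \<le> (LINT y:cube a l|lebesgue. \<bar>b y - ?m\<bar>)"
    unfolding set_lebesgue_integral_def by (rule integral_nonneg_AE) auto
  \<comment> \<open>The sign is forced by \<open>osc\<close>, whose left side is a nonnegative
    integral.\<close>
  have K: "0 \<le> K * l powr \<beta>"
    using order_trans[OF I osc] zero_less_power[OF l, of "CARD('n)"]
    by (metis mult_less_0_iff not_le)
  have "\<bar>mean (cube x s) b - ?m\<bar> \<le> (LINT y:cube x s|lebesgue. \<bar>b y - ?m\<bar>) / measure lebesgue (cube x s)"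
    by (rule mean_diff_le[OF bs]) (use s in \<open>auto simp: measure_cube\<close>)
  also have "\<dots> = (LINT y:cube x s|lebesgue. \<bar>b y - ?m\<bar>) / s ^ CARD('n)"
    using s by (simp add: measure_cube)
  also have "\<dots> \<le> (K * l powr \<beta> * l ^ CARD('n)) / s ^ CARD('n)"
    using set_integral_mono_set_nonneg[OF d sub] osc s by (intro divide_right_mono) auto
  also have "\<dots> \<le> (K * l powr \<beta> * (2 * s) ^ CARD('n)) / s ^ CARD('n)"
    using K s l by (intro divide_right_mono mult_left_mono power_mono) auto
  also have "\<dots> = 2 ^ CARD('n) * K * l powr \<beta>"
    using s by (simp add: power_mult_distrib)
  finally show ?thesis .
qed

text \<open>The continuous representative is the limit of the means over the cubes with lower corner \<open>x\<close>.\<close>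

lemma holder_of_mean_oscillation:
  fixes b :: "real^'n \<Rightarrow> real" and \<beta> K :: real
  defines "M \<equiv> 2 ^ CARD('n)"
  defines "C \<equiv> M / (1 - 2 powr (- \<beta>))"
  assumes \<beta>: "0 < \<beta>"
    and meas: "b \<in> borel_measurable lebesgue"
    and int: "\<And>a l. set_integrable lebesgue (cube a l) b"
    and osc: "\<And>a l. 0 < l \<Longrightarrow>
      (LINT y:cube a l|lebesgue. \<bar>b y - mean (cube a l) b\<bar>) \<le> K * l powr \<beta> * l ^ CARD('n)"
  shows "lipschitz_const \<beta> b (2 * (C + M * 2 powr \<beta>) * K)"
proof -
  define \<phi> where "\<phi> x l = mean (cube x l) b" for x l
  have half: "2 powr (- \<beta>) < 1" using \<beta> by (simp add: powr_less_one)
  \<comment> \<open>\<open>C\<close> is \<open>M\<close> times the sum of the geometric series with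
    ratio \<open>2 powr (- \<beta>)\<close>. This fixed point identity is what closes the induction
    in \<open>chain\<close>.\<close>
  have C: "C * 2 powr (- \<beta>) + M = C" "0 < C"
  proof -
    have "C * (1 - 2 powr (- \<beta>)) = M" using \<beta> half by (simp add: C_def)
    then show "C * 2 powr (- \<beta>) + M = C" by (simp add: algebra_simps)
    show "0 < C" using half by (simp add: C_def M_def)
  qed
  have "0 \<le> C * 2 powr (- \<beta>)" using C(2) by simp
  then have MC: "M \<le> C" using C(1) by linarith
  have M0: "0 < M" by (simp add: M_def)
  have K: "0 \<le> K"
  proof -
    have "0 \<le> (LINT y:cube 0 1|lebesgue. \<bar>b y - mean (cube 0 1) b\<bar>)"
      unfolding set_lebesgue_integral_def by (rule integral_nonneg_AE) auto
    then show ?thesis using osc[of 1 0] by simp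
  qed
  have nested: "\<bar>\<phi> x s - \<phi> a l\<bar> \<le> M * K * l powr \<beta>"
    if "0 < s" "s \<le> l" "l \<le> 2 * s" "cube x s \<subseteq> cube a l" for x a s l
    unfolding \<phi>_def M_def
    by (rule mean_diff_subcube) (use that int osc in auto)
  \<comment> \<open>Halve \<open>l\<close> until it is within a factor 2 of \<open>s\<close>;
    \<open>k\<close> bounds the number of halvings. Each halving costs one application of
    \<open>nested\<close>, and the costs decay geometrically.\<close>
  have chain: "\<bar>\<phi> x s - \<phi> x l\<bar> \<le> C * K * l powr \<beta>" if "0 < s" "s \<le> l" for x s l
  proof -
    obtain k where k: "l / s < 2 ^ k" using real_arch_pow[of 2 "l / s"] by auto
    have "l \<le> 2 ^ k * s" using k that by (simp add: field_simps)
    with that show ?thesis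
    proof (induction k arbitrary: l)
      case 0
      then have "l = s" by simp
      then show ?case using C K by simp
    next
      case (Suc k)
      show ?case
      proof (cases "l \<le> 2 * s")
        case True
        have "\<bar>\<phi> x s - \<phi> x l\<bar> \<le> M * K * l powr \<beta>"
          using Suc.prems True by (intro nested cube_subset) auto
        also have "\<dots> \<le> C * K * l powr \<beta>"
          using MC K by (intro mult_right_mono) auto
        finally show ?thesis .
      next
        case False
        then have l: "0 < s" "s \<le> l / 2" "l / 2 \<le> 2 ^ k * s" "0 < l" using Suc.prems by auto
        have "\<bar>\<phi> x s - \<phi> x (l / 2)\<bar> \<le> C * K * (l / 2) powr \<beta>"
          by (rule Suc.IH) (use l in auto)
        moreover have "\<bar>\<phi> x (l / 2) - \<phi> x l\<bar> \<le> M * K * l powr \<beta>"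
          using l by (intro nested cube_subset) auto
        moreover have "C * K * (l / 2) powr \<beta> + M * K * l powr \<beta> = (C * 2 powr (- \<beta>) + M) * (K * l powr \<beta>)"
          using l by (simp add: powr_divide powr_minus field_simps)
        ultimately show ?thesis unfolding C by (simp add: algebra_simps)
      qed
    qed
  qed
  define g where "g x = lim (\<lambda>k. \<phi> x (1 / real (Suc k)))" for x
  have lim: "(\<lambda>k. \<phi> x (1 / real (Suc k))) \<longlonglongrightarrow> g x" for x
  proof -
    have lim0: "(\<lambda>k. C * K * (1 / real (Suc k)) powr \<beta>) \<longlonglongrightarrow> 0"
      by (intro tendsto_mult_right_zero tendsto_zero_powrI[OF _ tendsto_const]
          LIMSEQ_Suc[OF lim_1_over_n] always_eventually) (use \<beta> in auto)
    have "Cauchy (\<lambda>k. \<phi> x (1 / real (Suc k)))"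
    proof (rule CauchyI')
      fix e :: real assume "0 < e"
      then obtain N where N: "\<And>k. k \<ge> N \<Longrightarrow> C * K * (1 / real (Suc k)) powr \<beta> < e"
        using order_tendstoD(2)[OF lim0] by (auto simp: eventually_sequentially)
      show "\<exists>N. \<forall>m\<ge>N. \<forall>n>m. dist (\<phi> x (1 / real (Suc m))) (\<phi> x (1 / real (Suc n))) < e"
      proof (intro exI allI impI)
        fix m n assume mn: "m \<ge> N" "n > m"
        have "\<bar>\<phi> x (1 / real (Suc n)) - \<phi> x (1 / real (Suc m))\<bar> \<le> C * K * (1 / real (Suc m)) powr \<beta>"
          by (rule chain) (use mn in \<open>auto simp: field_simps\<close>)
        then show "dist (\<phi> x (1 / real (Suc m))) (\<phi> x (1 / real (Suc n))) < e"
          using N[OF mn(1)] by (simp add: dist_real_def abs_minus_commute)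
      qed
    qed
    then show ?thesis unfolding g_def by (simp add: Cauchy_convergent_iff convergent_LIMSEQ_iff)
  qed
  \<comment> \<open>The small side in \<open>chain\<close> tends to 0 while \<open>l\<close> stays
    fixed.\<close>
  have approx: "\<bar>g x - \<phi> x l\<bar> \<le> C * K * l powr \<beta>" if "0 < l" for x l
  proof (rule LIMSEQ_le_const2)
    show "(\<lambda>k. \<bar>\<phi> x (1 / real (Suc k)) - \<phi> x l\<bar>) \<longlonglongrightarrow> \<bar>g x - \<phi> x l\<bar>"
      by (intro tendsto_rabs tendsto_diff lim tendsto_const)
    obtain N where N: "1 / l < real N" using reals_Archimedean2 by blast
    have "\<bar>\<phi> x (1 / real (Suc k)) - \<phi> x l\<bar> \<le> C * K * l powr \<beta>" if "k \<ge> N" for k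
    proof (rule chain)
      have "1 / l \<le> real (Suc k)" using N that by simp
      then show "1 / real (Suc k) \<le> l" using \<open>0 < l\<close> by (simp add: field_simps)
    qed simp
    then show "\<exists>N. \<forall>k\<ge>N. \<bar>\<phi> x (1 / real (Suc k)) - \<phi> x l\<bar> \<le> C * K * l powr \<beta>" by blast
  qed
  have double: "M * K * (2 * l) powr \<beta> = M * 2 powr \<beta> * K * l powr \<beta>" if "0 < l" for l
    using that by (simp add: powr_mult)
  have holder: "\<bar>g x - g y\<bar> \<le> 2 * (C + M * 2 powr \<beta>) * K * norm (x - y) powr \<beta>" for x y
  proof (cases "x = y")
    case False
    define r where "r = norm (x - y)"
    \<comment> \<open>With this corner, the cube of side \<open>2 * r\<close> contains the cubes of
      side \<open>r\<close> at both \<open>x\<close> and \<open>y\<close>, so both means compare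
      with the same one.\<close>
    define a where "a = (\<chi> i. min (x $ i) (y $ i))"
    have r: "0 < r" using False by (simp add: r_def)
    have "\<bar>x $ i - y $ i\<bar> \<le> r" for i
      using component_le_norm_cart[of "x - y" i] by (simp add: r_def)
    then have *: "x $ i \<le> y $ i + r" "y $ i \<le> x $ i + r" for i by (smt (verit))+
    have a: "a $ i \<le> x $ i" "a $ i \<le> y $ i" "x $ i + r \<le> a $ i + 2 * r" "y $ i + r \<le> a $ i + 2 * r" for i
      using *[of i] by (auto simp: a_def)
    have "\<bar>\<phi> x r - \<phi> a (2 * r)\<bar> \<le> M * K * (2 * r) powr \<beta>"
      by (intro nested cube_subset a) (use r in auto)
    moreover have "\<bar>\<phi> y r - \<phi> a (2 * r)\<bar> \<le> M * K * (2 * r) powr \<beta>"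
      by (intro nested cube_subset a) (use r in auto)
    ultimately have "\<bar>g x - g y\<bar> \<le> 2 * (C * K * r powr \<beta>) + 2 * (M * K * (2 * r) powr \<beta>)"
      using approx[OF r, of x] approx[OF r, of y] by linarith
    also have "\<dots> = 2 * (C + M * 2 powr \<beta>) * K * r powr \<beta>"
      unfolding double[OF r] by (simp add: algebra_simps)
    finally show ?thesis by (simp add: r_def)
  qed simp
  have g[measurable]: "g \<in> borel_measurable lebesgue"
    using holder_continuous[of g, OF holder \<beta>]
    by (intro measurable_completion) (simp add: borel_measurable_continuous_onI)
  note meas[measurable]
  \<comment> \<open>In \<open>dev\<close>, \<open>C\<close> pays for passing from \<open>g y\<close>
    to the mean over the cube at \<open>y\<close>. The other two terms pay for passing to the cube
    of side \<open>2 * l\<close> at \<open>a\<close> and back to side \<open>l\<close>.\<close>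
  define D where "D = C + 2 * (M * 2 powr \<beta>)"
  have D: "0 \<le> D" using C M0 by (simp add: D_def)
  have dev: "\<bar>g y - \<phi> a l\<bar> \<le> D * K * l powr \<beta>" if l: "0 < l" and y: "y \<in> cube a l" for a l y
  proof -
    have "a $ i \<le> y $ i" "y $ i \<le> a $ i + l" for i using y by (auto simp: mem_cube)
    then have y': "a $ i \<le> y $ i" "y $ i + l \<le> a $ i + 2 * l" for i by (smt (verit))+
    have "\<bar>\<phi> y l - \<phi> a (2 * l)\<bar> \<le> M * K * (2 * l) powr \<beta>"
      by (intro nested cube_subset y') (use l in auto)
    moreover have "\<bar>\<phi> a l - \<phi> a (2 * l)\<bar> \<le> M * K * (2 * l) powr \<beta>"
      by (intro nested cube_subset) (use l in auto)
    ultimately have "\<bar>g y - \<phi> a l\<bar> \<le> C * K * l powr \<beta> + 2 * (M * K * (2 * l) powr \<beta>)"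
      using approx[OF l, of y] by linarith
    also have "\<dots> = D * K * l powr \<beta>"
      unfolding double[OF l] D_def by (simp add: algebra_simps)
    finally show ?thesis .
  qed
  \<comment> \<open>On each cube \<open>\<bar>b - g\<bar>\<close> is at most
    \<open>\<bar>b - \<phi> a l\<bar>\<close>, controlled in mean by \<open>osc\<close>, plus the
    deviation bounded by \<open>dev\<close>. Its integral therefore has order
    \<open>l powr \<beta>\<close> times the volume.\<close>
  have "AE x in lebesgue. ennreal \<bar>b x - g x\<bar> = 0"
  proof (rule AE_zero_if_small_on_cubes[OF _ \<beta>, of _ "(1 + D) * K"])
    fix a :: "real^'n" and l :: real assume l: "0 < l"
    let ?Q = "cube a l"
    have d: "set_integrable lebesgue ?Q (\<lambda>y. \<bar>b y - \<phi> a l\<bar>)"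
      by (intro set_integrable_abs set_integral_diff(1) int absolutely_integrable_on_const) simp
    have "(\<integral>\<^sup>+x\<in>?Q. ennreal \<bar>b x - g x\<bar> \<partial>lebesgue)
        \<le> (\<integral>\<^sup>+x. ennreal (indicator ?Q x *\<^sub>R \<bar>b x - \<phi> a l\<bar>) + ennreal (D * K * l powr \<beta>) * indicator ?Q x \<partial>lebesgue)"
    proof (rule nn_integral_mono)
      fix x
      show "ennreal \<bar>b x - g x\<bar> * indicator ?Q x \<le>
        ennreal (indicator ?Q x *\<^sub>R \<bar>b x - \<phi> a l\<bar>) + ennreal (D * K * l powr \<beta>) * indicator ?Q x"
      proof (cases "x \<in> ?Q")
        case True
        then show ?thesis using dev[OF l True] D K
          by (auto simp flip: ennreal_plus intro!: ennreal_leI)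
      qed simp
    qed
    also have "\<dots> = ennreal (LINT x:?Q|lebesgue. \<bar>b x - \<phi> a l\<bar>) + ennreal (D * K * l powr \<beta>) * ennreal (l ^ CARD('n))"
    proof (subst nn_integral_add)
      have "(\<integral>\<^sup>+x. ennreal (indicator ?Q x *\<^sub>R \<bar>b x - \<phi> a l\<bar>) \<partial>lebesgue) = ennreal (LINT x:?Q|lebesgue. \<bar>b x - \<phi> a l\<bar>)"
        unfolding set_lebesgue_integral_def
        by (rule nn_integral_eq_integral) (use d in \<open>simp_all add: set_integrable_def\<close>)
      moreover have "(\<integral>\<^sup>+x\<in>?Q. ennreal (D * K * l powr \<beta>) \<partial>lebesgue) = ennreal (D * K * l powr \<beta>) * ennreal (l ^ CARD('n))"
        by (subst nn_integral_cmult_indicator) (simp_all add: emeasure_cube[OF l])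
      ultimately show "(\<integral>\<^sup>+x. ennreal (indicator ?Q x *\<^sub>R \<bar>b x - \<phi> a l\<bar>) \<partial>lebesgue)
          + (\<integral>\<^sup>+x\<in>?Q. ennreal (D * K * l powr \<beta>) \<partial>lebesgue)
        = ennreal (LINT x:?Q|lebesgue. \<bar>b x - \<phi> a l\<bar>) + ennreal (D * K * l powr \<beta>) * ennreal (l ^ CARD('n))"
        by simp
      show "(\<lambda>x. ennreal (indicator ?Q x *\<^sub>R \<bar>b x - \<phi> a l\<bar>)) \<in> borel_measurable lebesgue"
        using borel_measurable_integrable[OF d[unfolded set_integrable_def]] by (rule measurable_compose) simp
      show "(\<lambda>x. ennreal (D * K * l powr \<beta>) * indicator ?Q x) \<in> borel_measurable lebesgue"
        by (intro borel_measurable_times_ennreal borel_measurable_const borel_measurable_indicator lmeasurable_cbox[THEN fmeasurableD])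
    qed
    also have "\<dots> \<le> ennreal (K * l powr \<beta> * l ^ CARD('n)) + ennreal (D * K * l powr \<beta>) * ennreal (l ^ CARD('n))"
      unfolding \<phi>_def by (rule add_right_mono[OF ennreal_leI[OF osc[OF l]]])
    also have "\<dots> = ennreal ((1 + D) * K * l powr \<beta> * l ^ CARD('n))"
    proof -
      have "0 \<le> K * l powr \<beta> * l ^ CARD('n)" "0 \<le> D * K * l powr \<beta>" "0 \<le> l ^ CARD('n)"
        using D K l by auto
      then have "ennreal (K * l powr \<beta> * l ^ CARD('n)) + ennreal (D * K * l powr \<beta>) * ennreal (l ^ CARD('n))
          = ennreal (K * l powr \<beta> * l ^ CARD('n) + D * K * l powr \<beta> * l ^ CARD('n))"
        by (metis ennreal_mult ennreal_plus mult_nonneg_nonneg)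
      moreover have "K * l powr \<beta> * l ^ CARD('n) + D * K * l powr \<beta> * l ^ CARD('n)
          = (1 + D) * K * l powr \<beta> * l ^ CARD('n)"
        by (simp only: distrib_right mult_1)
      ultimately show ?thesis by (simp only:)
    qed
    finally show "(\<integral>\<^sup>+x\<in>?Q. ennreal \<bar>b x - g x\<bar> \<partial>lebesgue) \<le> ennreal ((1 + D) * K * l powr \<beta> * l ^ CARD('n))" .
  qed (use D K in auto)
  then have "AE x in lebesgue. b x = g x" by (auto elim: eventually_mono)
  then show ?thesis unfolding lipschitz_const_def using holder by blast
qed

subsection \<open>Maximal functions\<close>

text \<open>This passes from the extended averages in the maximal functions to real integrals, for
  which linearity and subtraction are available.\<close>

lemma cube_average_nn:
  fixes h :: "real^'n \<Rightarrow> real"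
  assumes l: "0 < l" and h: "set_integrable lebesgue (cube a l) h" "\<And>x. 0 \<le> h x"
  shows "1 / emeasure lebesgue (cube a l) * (\<integral>\<^sup>+y\<in>cube a l. ennreal (h y) \<partial>lebesgue)
    = ennreal ((LINT y:cube a l|lebesgue. h y) / l ^ CARD('n))"
proof -
  let ?Q = "cube a l"
  have "(\<integral>\<^sup>+y\<in>?Q. ennreal (h y) \<partial>lebesgue) = (\<integral>\<^sup>+y. ennreal (indicator ?Q y *\<^sub>R h y) \<partial>lebesgue)"
    by (intro nn_integral_cong) (auto simp: indicator_def)
  also have "\<dots> = ennreal (LINT y:?Q|lebesgue. h y)"
    using h unfolding set_integrable_def set_lebesgue_integral_def
    by (intro nn_integral_eq_integral) auto
  finally have "1 / emeasure lebesgue ?Q * (\<integral>\<^sup>+y\<in>?Q. ennreal (h y) \<partial>lebesgue)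
      = ennreal 1 / ennreal (l ^ CARD('n)) * ennreal (LINT y:?Q|lebesgue. h y)"
    by (simp add: emeasure_cube l)
  also have "\<dots> = ennreal (1 / l ^ CARD('n)) * ennreal (LINT y:?Q|lebesgue. h y)"
    using l by (subst divide_ennreal) auto
  also have "\<dots> = ennreal ((LINT y:?Q|lebesgue. h y) / l ^ CARD('n))"
    using l by (simp add: ennreal_mult'[symmetric])
  finally show ?thesis .
qed

lemma HL_max_ge:
  fixes f :: "real^'n \<Rightarrow> real"
  assumes "0 < l" "set_integrable lebesgue (cube a l) f" "x \<in> cube a l"
  shows "ennreal ((LINT y:cube a l|lebesgue. \<bar>f y\<bar>) / l ^ CARD('n)) \<le> HL_max f x"
proof -
  have "ennreal ((LINT y:cube a l|lebesgue. \<bar>f y\<bar>) / l ^ CARD('n)) =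
      1 / emeasure lebesgue (cube a l) * (\<integral>\<^sup>+y\<in>cube a l. ennreal \<bar>f y\<bar> \<partial>lebesgue)"
    by (rule cube_average_nn[symmetric]) (use assms set_integrable_abs in auto)
  also have "\<dots> \<le> HL_max f x"
    unfolding HL_max_def by (rule SUP_upper) (use assms cube_in_cubes in auto)
  finally show ?thesis .
qed

lemma set_integrable_dist_const:
  fixes f :: "real^'n \<Rightarrow> real"
  assumes "set_integrable lebesgue (cube a l) f"
  shows "set_integrable lebesgue (cube a l) (\<lambda>y. \<bar>f y - c\<bar>)"
  by (intro set_integrable_abs set_integral_diff(1) assms absolutely_integrable_on_const) simp

lemma sharp_max_ge:
  fixes f :: "real^'n \<Rightarrow> real"
  assumes "0 < l" "set_integrable lebesgue (cube a l) f" "x \<in> cube a l"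
  shows "ennreal ((LINT y:cube a l|lebesgue. \<bar>f y - mean (cube a l) f\<bar>) / l ^ CARD('n)) \<le> sharp_max f x"
proof -
  have "ennreal ((LINT y:cube a l|lebesgue. \<bar>f y - mean (cube a l) f\<bar>) / l ^ CARD('n)) =
      1 / emeasure lebesgue (cube a l) * (\<integral>\<^sup>+y\<in>cube a l. ennreal \<bar>f y - mean (cube a l) f\<bar> \<partial>lebesgue)"
    by (rule cube_average_nn[symmetric]) (use assms set_integrable_dist_const in auto)
  also have "\<dots> \<le> sharp_max f x"
    unfolding sharp_max_def by (rule SUP_upper) (use assms cube_in_cubes in auto)
  finally show ?thesis .
qed

lemma sharp_max_le:
  fixes f :: "real^'n \<Rightarrow> real"
  assumes int: "\<And>a l. set_integrable lebesgue (cube a l) f"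
    and le: "\<And>a l. 0 < l \<Longrightarrow> x \<in> cube a l \<Longrightarrow>
      (LINT y:cube a l|lebesgue. \<bar>f y - mean (cube a l) f\<bar>) \<le> c * l ^ CARD('n)"
  shows "sharp_max f x \<le> ennreal c"
  unfolding sharp_max_def
proof (rule SUP_least)
  fix Q assume "Q \<in> {Q \<in> cubes. x \<in> Q}"
  then obtain a l where Q: "Q = cube a l" "0 < l" "x \<in> cube a l" by (auto simp: mem_cubes_iff)
  show "1 / emeasure lebesgue Q * (\<integral>\<^sup>+y\<in>Q. ennreal \<bar>f y - mean Q f\<bar> \<partial>lebesgue) \<le> ennreal c"
    unfolding Q
    by (subst cube_average_nn)
      (use Q int le[of l a] in \<open>auto intro!: ennreal_leI set_integrable_dist_const simp: pos_divide_le_eq\<close>)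
qed

text \<open>The test cube has the same corner and twice the volume, so the truncated function has mean
  \<open>mean Q b / 2\<close> on it.\<close>

lemma sharp_max_truncation_ge_mean:
  fixes b :: "real^'n \<Rightarrow> real"
  assumes l: "0 < l" and b: "set_integrable lebesgue (cube a l) b" and x: "x \<in> cube a l"
  shows "ennreal (\<bar>mean (cube a l) b\<bar> / 2) \<le> sharp_max (\<lambda>y. b y * indicator (cube a l) y) x"
proof -
  define s where "s = l * 2 powr (1 / real CARD('n))"
  let ?Q = "cube a l" and ?P = "cube a s"
  define m where "m = mean ?Q b"
  define f where "f y = b y * indicator ?Q y" for y
  have "1 \<le> 2 powr (1 / real CARD('n))" by (simp add: ge_one_powr_ge_zero)
  then have s: "0 < s" "l \<le> s" using l by (auto simp: s_def)
  have sn: "s ^ CARD('n) = 2 * l ^ CARD('n)"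
    by (simp add: s_def power_mult_distrib powr_powr flip: powr_realpow)
  have sub: "?Q \<subseteq> ?P" by (rule cube_subset) (use s in auto)
  have fint: "integrable lebesgue f"
    using b unfolding set_integrable_def f_def by (simp add: mult.commute)
  have fP: "set_integrable lebesgue ?P f"
    unfolding set_integrable_def by (rule integrable_mult_indicator) (use fint in auto)
  have ind: "integrable lebesgue (indicator ?Q :: _ \<Rightarrow> real)" "integrable lebesgue (indicator ?P :: _ \<Rightarrow> real)"
    by (auto intro!: integrable_real_indicator simp: emeasure_cube l s)
  have If: "integral\<^sup>L lebesgue f = m * l ^ CARD('n)"
    using l by (simp add: m_def mean_def set_lebesgue_integral_def f_def[abs_def] measure_cube mult.commute)
  have "(LINT y:?P|lebesgue. f y) = integral\<^sup>L lebesgue f"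
    unfolding set_lebesgue_integral_def
    by (rule Bochner_Integration.integral_cong) (use sub in \<open>auto simp: f_def indicator_def\<close>)
  then have mP: "mean ?P f = m / 2"
    using l s by (simp add: mean_def measure_cube sn If)
  \<comment> \<open>On \<open>?Q\<close> this is \<open>sgn m * (b y - m / 2)\<close>, on the rest
    of \<open>?P\<close> it is \<open>\<bar>m\<bar> / 2\<close>, and outside \<open>?P\<close> it is
    0. Hence it minorizes the oscillation integrand. The two halves of the volume of
    \<open>?P\<close> contribute equally to its integral.\<close>
  define u where "u y = sgn m * (f y - m * indicator ?Q y + m / 2 * indicator ?P y)" for y
  have "integral\<^sup>L lebesgue u = sgn m * (m * l ^ CARD('n) - m * l ^ CARD('n) + m / 2 * (2 * l ^ CARD('n)))"
    unfolding u_def using ind fint l s by (simp add: If measure_cube sn)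
  also have "\<dots> = \<bar>m\<bar> * l ^ CARD('n)" by (simp add: abs_sgn mult.commute)
  finally have "\<bar>m\<bar> * l ^ CARD('n) = integral\<^sup>L lebesgue u" by simp
  also have "\<dots> \<le> (LINT y:?P|lebesgue. \<bar>f y - mean ?P f\<bar>)"
    unfolding set_lebesgue_integral_def
  proof (rule integral_mono)
    show "integrable lebesgue u" unfolding u_def using ind fint by simp
    show "integrable lebesgue (\<lambda>y. indicator ?P y *\<^sub>R \<bar>f y - mean ?P f\<bar>)"
      using set_integrable_dist_const[OF fP] by (simp add: set_integrable_def)
    fix y
    show "u y \<le> indicator ?P y *\<^sub>R \<bar>f y - mean ?P f\<bar>"
      using sub by (cases "y \<in> ?Q"; cases "y \<in> ?P")
        (auto simp: u_def mP f_def sgn_if)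
  qed
  finally have "\<bar>m\<bar> / 2 \<le> (LINT y:?P|lebesgue. \<bar>f y - mean ?P f\<bar>) / s ^ CARD('n)"
    using l by (simp add: sn field_simps)
  then have "ennreal (\<bar>m\<bar> / 2) \<le> ennreal ((LINT y:?P|lebesgue. \<bar>f y - mean ?P f\<bar>) / s ^ CARD('n))"
    by (rule ennreal_leI)
  also have "\<dots> \<le> sharp_max f x"
    by (rule sharp_max_ge) (use s fP sub x in auto)
  finally show ?thesis by (simp add: m_def f_def[abs_def])
qed

text \<open>The mean oscillation of an indicator of relative density \<open>t\<close> is \<open>2 t (1 - t) \<le> 1/2\<close>.\<close>

lemma sharp_max_le_near_indicator:
  fixes f :: "real^'n \<Rightarrow> real"
  assumes f: "\<And>a l. set_integrable lebesgue (cube a l) f"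
    and Q[measurable]: "Q \<in> sets lebesgue" and c: "0 \<le> c" and \<epsilon>: "0 \<le> \<epsilon>"
    and near: "AE y in lebesgue. \<bar>f y - c * indicator Q y\<bar> \<le> \<epsilon>"
  shows "sharp_max f x \<le> ennreal (c / 2 + 2 * \<epsilon>)"
proof (rule sharp_max_le[OF f])
  fix a :: "real^'n" and l :: real assume l: "0 < l"
  let ?P = "cube a l" and ?m = "l ^ CARD('n)"
  have m: "0 < ?m" using l by simp
  define t where "t = measure lebesgue (Q \<inter> ?P) / ?m"
  have mQ: "measure lebesgue (Q \<inter> ?P) = t * ?m" using l by (simp add: t_def)
  have "measure lebesgue (Q \<inter> ?P) \<le> measure lebesgue ?P"
    by (rule measure_mono_fmeasurable) auto
  then have t: "0 \<le> t" "t \<le> 1" using m l by (auto simp: t_def measure_cube)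
  have indQ: "set_integrable lebesgue ?P (indicator Q :: _ \<Rightarrow> real)"
    unfolding set_integrable_def
  proof -
    have "integrable lebesgue (indicator (?P \<inter> Q) :: _ \<Rightarrow> real)"
      by (rule integrable_real_indicator)
        (auto intro: le_less_trans[OF emeasure_mono[of _ ?P]] simp: emeasure_cube l)
    also have "(indicator (?P \<inter> Q) :: _ \<Rightarrow> real) = (\<lambda>x. indicator ?P x *\<^sub>R indicator Q x)"
      by (auto simp: indicator_def)
    finally show "integrable lebesgue (\<lambda>x. indicat_real ?P x *\<^sub>R indicat_real Q x)" .
  qed
  have IQ: "(LINT y:?P|lebesgue. indicator Q y) = t * ?m"
  proof -
    have "(LINT y:?P|lebesgue. indicator Q y) = integral\<^sup>L lebesgue (indicator (Q \<inter> ?P) :: _ \<Rightarrow> real)"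
      unfolding set_lebesgue_integral_def
      by (intro Bochner_Integration.integral_cong) (auto simp: indicator_def)
    also have "\<dots> = t * ?m" by (simp add: mQ)
    finally show ?thesis .
  qed
  have Ic: "(LINT y:?P|lebesgue. k) = k * ?m" for k :: real
    using l by (simp add: set_integral_const measure_cube emeasure_cube)
  note k = absolutely_integrable_on_const[of ?P, simplified]
  \<comment> \<open>The perturbation \<open>h\<close> moves a value of \<open>f\<close> by at most
    \<epsilon> almost everywhere and a mean by at most \<epsilon>, which accounts for
    \<open>2 * \<epsilon>\<close>.\<close>
  define h where "h y = f y - c * indicator Q y" for y
  have h: "set_integrable lebesgue ?P h"
    unfolding h_def by (intro set_integral_diff(1) f set_integrable_mult_right indQ)
  have "\<bar>mean ?P h\<bar> \<le> (LINT y:?P|lebesgue. \<bar>h y - 0\<bar>) / measure lebesgue ?P"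
    using mean_diff_le[OF h, of 0] l by (simp add: measure_cube)
  also have "(LINT y:?P|lebesgue. \<bar>h y - 0\<bar>) \<le> (LINT y:?P|lebesgue. \<epsilon>)"
    by (rule set_integral_mono_AE) (use set_integrable_abs[OF h] k near in \<open>auto simp: h_def\<close>)
  finally have mh: "\<bar>mean ?P h\<bar> \<le> \<epsilon>"
    using m l by (simp add: Ic measure_cube divide_right_mono)
  have "(LINT y:?P|lebesgue. h y) = (LINT y:?P|lebesgue. f y) - c * (t * ?m)"
    unfolding h_def
    by (subst set_integral_diff(2)) (use f indQ in \<open>auto simp: IQ\<close>)
  then have mf: "mean ?P f = mean ?P h + c * t"
    using m l by (simp add: mean_def measure_cube field_simps)
  \<comment> \<open>For \<open>t\<close> between 0 and 1,
    \<open>(1 - 2 * t) * indicator Q y + t\<close> is a linear expression for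
    \<open>\<bar>indicator Q y - t\<bar>\<close>, so its integral is immediate.\<close>
  define v where "v y = c * ((1 - 2 * t) * indicator Q y + t) + 2 * \<epsilon>" for y
  have v: "set_integrable lebesgue ?P v" "(LINT y:?P|lebesgue. v y) = (c * (2 * t * (1 - t)) + 2 * \<epsilon>) * ?m"
    unfolding v_def by (auto simp: set_integral_add indQ k IQ Ic algebra_simps)
  have "(LINT y:?P|lebesgue. \<bar>f y - mean ?P f\<bar>) \<le> (LINT y:?P|lebesgue. v y)"
  proof (rule set_integral_mono_AE[OF set_integrable_dist_const[OF f] v(1)])
    show "AE y\<in>?P in lebesgue. \<bar>f y - mean ?P f\<bar> \<le> v y"
      using near
    proof eventually_elim
      case (elim y)
      have "\<bar>f y - mean ?P f\<bar> \<le> \<bar>c * indicator Q y - c * t\<bar> + 2 * \<epsilon>"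
        using elim mh mf by linarith
      also have "\<bar>c * indicator Q y - c * t\<bar> = c * \<bar>indicator Q y - t\<bar>"
        using c by (simp add: abs_mult flip: right_diff_distrib)
      also have "\<bar>indicator Q y - t\<bar> = (1 - 2 * t) * indicator Q y + t"
        using t by (auto simp: indicator_def)
      finally show ?case by (simp add: v_def)
    qed
  qed
  also have "\<dots> \<le> (c / 2 + 2 * \<epsilon>) * ?m"
  proof -
    have "0 \<le> (2 * t - 1)\<^sup>2" by simp
    then have "2 * t * (1 - t) \<le> 1 / 2" by (simp add: power2_eq_square algebra_simps)
    then have "c * (2 * t * (1 - t)) \<le> c * (1 / 2)" using c by (rule mult_left_mono)
    then show ?thesis unfolding v(2) using m by (intro mult_right_mono) auto
  qed
  finally show "(LINT y:?P|lebesgue. \<bar>f y - mean ?P f\<bar>) \<le> (c / 2 + 2 * \<epsilon>) * ?m" .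
qed

subsection \<open>Comparison of the two spaces\<close>

text \<open>The points \<open>0\<close> and \<open>vec 1\<close> are distinct, so testing the
  condition there forces the sign. Thus the infimum in \<open>Lip_norm\<close> is over a set bounded
  below.\<close>

lemma lipschitz_const_nonneg:
  fixes b :: "real^'n \<Rightarrow> real"
  assumes "lipschitz_const \<beta> b C"
  shows "0 \<le> C"
proof -
  obtain g :: "real^'n \<Rightarrow> real" where "\<And>x y. \<bar>g x - g y\<bar> \<le> C * norm (x - y) powr \<beta>"
    using assms by (auto simp: lipschitz_const_def)
  from this[of 0 "vec 1"] have "0 \<le> C * norm (0 - vec 1 :: real^'n) powr \<beta>" by (rule order_trans[rotated]) simp
  moreover have "0 < norm (0 - vec 1 :: real^'n) powr \<beta>" by (simp add: vec_eq_iff)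
  ultimately show ?thesis by (simp add: zero_le_mult_iff)
qed

lemma L1_loc_cube: "b \<in> L1_loc \<Longrightarrow> set_integrable lebesgue (cube a l) b"
  by (simp add: L1_loc_def)

section \<open>From nonnegative Lipschitz functions to the sharp space\<close>

lemma Lip_subset_L1_loc:
  assumes "0 < \<beta>"
  shows "Lip \<beta> \<subseteq> L1_loc"
proof
  fix b :: "real^'n \<Rightarrow> real" assume "b \<in> Lip \<beta>"
  then obtain C g where ae: "AE x in lebesgue. b x = g x"
    and g: "\<And>x y. \<bar>g x - g y\<bar> \<le> C * norm (x - y) powr \<beta>"
    by (auto simp: Lip_def lipschitz_const_def)
  have cont: "continuous_on UNIV g" by (rule holder_continuous[OF g assms])
  then have gm: "g \<in> borel_measurable lebesgue"
    by (intro measurable_completion) (simp add: borel_measurable_continuous_onI)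
  \<comment> \<open>Measurability passes from the continuous representative to \<open>b\<close>
    because Lebesgue measure is complete.\<close>
  have ae': "AE x in lebesgue. g x = b x" using ae by (auto elim: eventually_mono)
  note bm = borel_measurable_AE[OF gm ae']
  have "b absolutely_integrable_on K" if K: "compact K" for K
  proof -
    obtain a c where "K \<subseteq> cbox a c"
      using bounded_subset_cbox_symmetric[OF compact_imp_bounded[OF K]] by blast
    moreover have "g absolutely_integrable_on cbox a c"
      using cont by (intro absolutely_integrable_continuous) (auto intro: continuous_on_subset)
    ultimately have "g absolutely_integrable_on K"
      by (rule set_integrable_subset[rotated 2]) (use K in \<open>simp add: borel_compact\<close>)
    then show ?thesis
      unfolding set_integrable_def
      by (rule Bochner_Integration.integrable_cong_AE_imp)
        (use bm K ae' in \<open>auto simp: borel_compact elim!: eventually_mono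
          intro!: borel_measurable_times borel_measurable_indicator\<close>)
  qed
  with bm show "b \<in> L1_loc" by (simp add: L1_loc_def)
qed

text \<open>Both estimates of the sharp maximal function are used: the truncation is within
  \<epsilon> of \<open>b x\<close> times the indicator, which bounds it above, and the mean of
  \<open>b\<close> on the cube is within \<epsilon> of \<open>b x\<close>, which bounds it
  below.\<close>

lemma deviation_from_sharp_max_le:
  fixes b :: "real^'n \<Rightarrow> real"
  assumes b: "b \<in> L1_loc" and l: "0 < l" and x: "x \<in> cube a l"
    and \<epsilon>: "0 \<le> \<epsilon>" and bx: "0 \<le> b x"
    and near: "AE y in lebesgue. y \<in> cube a l \<longrightarrow> \<bar>b y - b x\<bar> \<le> \<epsilon>"
  shows "\<bar>ereal (b x) - 2 * enn2ereal (sharp_max (\<lambda>y. b y * indicator (cube a l) y) x)\<bar> \<le> ereal (4 * \<epsilon>)"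
proof -
  let ?Q = "cube a l" and ?f = "\<lambda>y. b y * indicator (cube a l) y"
  note bQ = L1_loc_cube[OF b, of a l]
  have "integrable lebesgue ?f"
    using bQ unfolding set_integrable_def by (simp add: mult.commute)
  then have f: "set_integrable lebesgue (cube c s) ?f" for c s
    unfolding set_integrable_def by (intro integrable_mult_indicator) auto
  have up: "sharp_max ?f x \<le> ennreal (b x / 2 + 2 * \<epsilon>)"
    by (rule sharp_max_le_near_indicator[OF f _ bx \<epsilon>, of ?Q])
      (use near \<epsilon> in \<open>auto elim!: eventually_mono simp: indicator_def\<close>)
  then obtain r where r: "sharp_max ?f x = ennreal r" "0 \<le> r"
    using le_less_trans[OF up ennreal_less_top] by (cases "sharp_max ?f x") auto
  have r_le: "r \<le> b x / 2 + 2 * \<epsilon>" using up bx \<epsilon> unfolding r by (simp del: ennreal_plus)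
  have "\<bar>mean ?Q b\<bar> / 2 \<le> r"
    using sharp_max_truncation_ge_mean[OF l bQ x] unfolding r by (simp add: r(2))
  moreover have "b x - \<epsilon> \<le> mean ?Q b"
  proof -
    have "\<bar>mean ?Q b - b x\<bar> \<le> (LINT y:?Q|lebesgue. \<bar>b y - b x\<bar>) / measure lebesgue ?Q"
      by (rule mean_diff_le[OF bQ]) (use l in \<open>auto simp: measure_cube\<close>)
    also have "(LINT y:?Q|lebesgue. \<bar>b y - b x\<bar>) \<le> (LINT y:?Q|lebesgue. \<epsilon>)"
      by (rule set_integral_mono_AE)
        (use near absolutely_integrable_on_const[of ?Q \<epsilon>] set_integrable_dist_const[OF bQ] in auto)
    also have "\<dots> / measure lebesgue ?Q = \<epsilon>"
      using l by (simp add: set_integral_const measure_cube emeasure_cube)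
    finally show ?thesis using l by (simp add: measure_cube divide_right_mono)
  qed
  \<comment> \<open>The upper bound on \<open>r\<close> gives
    \<open>b x - 2 * r \<ge> - 4 * \<epsilon>\<close>; the mean gives the sharper bound \<epsilon>
    on the other side.\<close>
  ultimately have "\<bar>b x - 2 * r\<bar> \<le> 4 * \<epsilon>" using r_le \<epsilon> by linarith
  moreover have "ereal (b x) - 2 * enn2ereal (ennreal r) = ereal (b x - 2 * r)"
    using r(2) by (simp add: enn2ereal_ennreal)
  ultimately show ?thesis unfolding r by simp
qed

text \<open>The oscillation on a cube of side \<open>l\<close> is at most
  \<open>C * (real CARD('n) * l) powr \<beta>\<close>, and the normalization cancels
  \<open>l powr \<beta>\<close>. Positivity of \<open>C\<close> gives the positive factor that
  \<open>Lp_norm_cmult\<close> asks for.\<close>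

lemma sharp_norm_le:
  fixes b q :: "real^'n \<Rightarrow> real"
  assumes \<beta>: "0 < \<beta>" and q: "\<And>x. 1 \<le> q x" and b: "b \<in> L1_loc" "AE x in lebesgue. 0 \<le> b x"
    and C: "0 < C" "lipschitz_const \<beta> b C"
  shows "sharp_norm \<beta> q b \<le> ennreal (4 * real CARD('n) powr \<beta> * C)"
  unfolding sharp_norm_def
proof (rule SUP_least)
  fix Q :: "(real^'n) set" assume "Q \<in> cubes"
  then obtain a l where Q: "Q = cube a l" and l: "0 < l" by (auto simp: mem_cubes_iff)
  obtain g where ae: "AE x in lebesgue. b x = g x"
    and g: "\<And>x y. \<bar>g x - g y\<bar> \<le> C * norm (x - y) powr \<beta>"
    using C by (auto simp: lipschitz_const_def)
  define \<epsilon> where "\<epsilon> = C * (real CARD('n) * l) powr \<beta>"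
  have \<epsilon>: "0 < \<epsilon>" using C l by (simp add: \<epsilon>_def)
  have near: "\<bar>g y - g x\<bar> \<le> \<epsilon>" if "x \<in> Q" "y \<in> Q" for x y
  proof -
    have "norm (y - x) \<le> real CARD('n) * l"
      using that by (intro norm_diff_le_cube) (auto simp: Q)
    then have "C * norm (y - x) powr \<beta> \<le> \<epsilon>"
      unfolding \<epsilon>_def using C \<beta> by (intro mult_left_mono powr_mono2) auto
    with g[of y x] show ?thesis by linarith
  qed
  let ?d = "\<lambda>x. (ereal (b x) - 2 * enn2ereal (sharp_max (\<lambda>y. b y * indicator Q y) x)) * indicator Q x"
  let ?N = "Lp_norm q (indicator Q)"
  have N: "?N < \<infinity>" "0 < ?N"
    unfolding Q by (rule Lp_norm_indicator_cube[OF l q])+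
  have "Lp_norm q ?d \<le> Lp_norm q (\<lambda>x. ereal (4 * \<epsilon>) * indicator Q x)"
  proof (rule Lp_norm_mono_AE)
    show "AE x in lebesgue. \<bar>?d x\<bar> \<le> \<bar>ereal (4 * \<epsilon>) * indicator Q x\<bar>"
      using ae b(2)
    proof eventually_elim
      case (elim x)
      show ?case
      proof (cases "x \<in> Q")
        case True
        have "AE y in lebesgue. y \<in> Q \<longrightarrow> \<bar>b y - b x\<bar> \<le> \<epsilon>"
          using ae by eventually_elim (use near[OF True] elim in auto)
        then have "\<bar>?d x\<bar> \<le> ereal (4 * \<epsilon>)"
          using deviation_from_sharp_max_le[OF b(1) l, of x a \<epsilon>] True \<epsilon> elim by (simp add: Q)
        then show ?thesis using True \<epsilon> by simp
      qed simp
    qed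
    show "0 \<le> q x" for x using q[of x] by simp
  qed
  also have "\<dots> = ennreal (4 * \<epsilon>) * ?N" using \<epsilon> by (intro Lp_norm_cmult) simp
  finally have "Lp_norm q ?d / ?N \<le> ennreal (4 * \<epsilon>) * ?N / ?N"
    by (rule divide_right_mono_ennreal)
  also have "\<dots> = ennreal (4 * \<epsilon>)"
    using N by (subst ennreal_mult_divide_eq) auto
  finally have "1 / ennreal (measure lebesgue Q powr (\<beta> / real CARD('n))) * (Lp_norm q ?d / ?N)
      \<le> ennreal 1 / ennreal (l powr \<beta>) * ennreal (4 * \<epsilon>)"
    unfolding Q measure_powr_cube[OF l] by (intro mult_mono) auto
  also have "\<dots> = ennreal (1 / l powr \<beta>) * ennreal (4 * \<epsilon>)"
    using l by (subst divide_ennreal) auto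
  also have "\<dots> = ennreal (4 * real CARD('n) powr \<beta> * C)"
    using l \<epsilon> by (simp add: \<epsilon>_def powr_mult mult_ac flip: ennreal_mult)
  finally show "1 / ennreal (measure lebesgue Q powr (\<beta> / real CARD('n))) * (Lp_norm q ?d / ?N)
      \<le> ennreal (4 * real CARD('n) powr \<beta> * C)" .
qed

section \<open>From the sharp space to nonnegative Lipschitz functions\<close>

lemma Lp_space_if_norm_finite:
  assumes "f \<in> borel_measurable lebesgue" "Lp_norm p (\<lambda>x. ereal (f x)) < \<infinity>"
  shows "f \<in> Lp_space p"
proof -
  obtain t where t: "0 < t" "modular p (\<lambda>x. ereal (f x) / ereal t) \<le> 1"
    using assms(2) unfolding Lp_norm_def Inf_less_iff by blast
  have "modular p (\<lambda>x. ereal (f x) / ereal t) < \<infinity>"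
    by (rule le_less_trans[OF t(2)]) simp
  with t(1) assms(1) show ?thesis unfolding Lp_space_def by blast
qed

text \<open>Only the lower bound \<open>2 M\<^sup>\<sharp>(b \<chi>\<^sub>Q) \<ge> \<bar>b\<^sub>Q\<bar>\<close> on \<open>Q\<close> enters, so the measurability of the sharp
  maximal function is never needed. The boundedness of the Hardy-Littlewood maximal operator
  replaces the duality of the norms of \<open>\<chi>\<^sub>Q\<close>.\<close>

lemma integral_mean_excess_le:
  fixes b q :: "real^'n \<Rightarrow> real"
  assumes q: "\<And>x. 1 \<le> q x"
    and max_bound: "\<And>f. f \<in> Lp_space q \<Longrightarrow>
      Lp_norm q (\<lambda>x. enn2ereal (HL_max f x)) \<le> ennreal B * Lp_norm q (\<lambda>x. ereal (f x))"
    and b: "b \<in> L1_loc" and A: "0 \<le> A" "sharp_norm \<beta> q b \<le> ennreal A" and B: "0 \<le> B"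
    and l: "0 < l"
  shows "(LINT y:cube a l|lebesgue. max 0 (\<bar>mean (cube a l) b\<bar> - b y)) \<le> B * A * l powr \<beta> * l ^ CARD('n)"
proof -
  define Q where "Q = cube a l"
  define m where "m = mean Q b"
  note bQ = L1_loc_cube[OF b, of a l, folded Q_def]
  have [measurable]: "b \<in> borel_measurable lebesgue" "Q \<in> sets lebesgue"
    using b by (auto simp: L1_loc_def Q_def)
  define f where "f y = max 0 (\<bar>m\<bar> - b y) * indicator Q y" for y
  have [measurable]: "f \<in> borel_measurable lebesgue" unfolding f_def[abs_def] by measurable
  let ?d = "\<lambda>x. (ereal (b x) - 2 * enn2ereal (sharp_max (\<lambda>y. b y * indicator Q y) x)) * indicator Q x"
  let ?N = "Lp_norm q (indicator Q)"
  have N: "?N < \<infinity>" "0 < ?N"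
    unfolding Q_def by (rule Lp_norm_indicator_cube[OF l q])+
  have q0: "0 \<le> q x" for x using q[of x] by simp
  have "Lp_norm q ?d / ?N = ennreal (l powr \<beta>) * (1 / ennreal (l powr \<beta>) * (Lp_norm q ?d / ?N))"
  proof -
    have "ennreal (l powr \<beta>) * (1 / ennreal (l powr \<beta>)) = 1"
      using l by (simp add: ennreal_times_divide)
    then show ?thesis by (simp add: mult.assoc[symmetric])
  qed
  also have "1 / ennreal (l powr \<beta>) * (Lp_norm q ?d / ?N) \<le> sharp_norm \<beta> q b"
    unfolding sharp_norm_def
    by (rule SUP_upper2[of Q]) (use l in \<open>simp_all only: Q_def cube_in_cubes measure_powr_cube order_refl\<close>)
  also note A(2)
  finally have dN: "Lp_norm q ?d / ?N \<le> ennreal (l powr \<beta>) * ennreal A"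
    by (simp add: mult_left_mono)
  have "Lp_norm q ?d = ?N * (Lp_norm q ?d / ?N)"
  proof -
    have "?N * (Lp_norm q ?d / ?N) = Lp_norm q ?d * ?N / ?N"
      by (simp only: ennreal_times_divide mult.commute)
    also have "\<dots> = Lp_norm q ?d" using N by (intro ennreal_mult_divide_eq) auto
    finally show ?thesis by simp
  qed
  also have "\<dots> \<le> ?N * (ennreal (l powr \<beta>) * ennreal A)"
    by (intro mult_left_mono dN) simp
  finally have d: "Lp_norm q ?d \<le> ennreal (l powr \<beta> * A) * ?N"
    using A by (simp add: ennreal_mult mult.commute)
  \<comment> \<open>On \<open>Q\<close>, twice the sharp maximal function is at least
    \<open>\<bar>m\<bar>\<close>, so where \<open>b x < \<bar>m\<bar>\<close> the difference lies
    below the negative number \<open>b x - \<bar>m\<bar>\<close>. If the sharp maximal function is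
    infinite, so is the right side.\<close>
  have f_le: "\<bar>ereal (f x)\<bar> \<le> \<bar>?d x\<bar>" for x
  proof (cases "x \<in> Q")
    case True
    have "ennreal (\<bar>m\<bar> / 2) \<le> sharp_max (\<lambda>y. b y * indicator Q y) x"
      using sharp_max_truncation_ge_mean[of l a b x] l bQ True by (simp add: Q_def m_def)
    then show ?thesis
    proof (cases "sharp_max (\<lambda>y. b y * indicator Q y) x")
      case (real r)
      then have "\<bar>m\<bar> / 2 \<le> r" using \<open>ennreal (\<bar>m\<bar> / 2) \<le> _\<close> by simp
      then show ?thesis using True real by (auto simp: f_def enn2ereal_ennreal max_def)
    qed (use True in \<open>simp add: f_def\<close>)
  qed (simp add: f_def)
  have "Lp_norm q (\<lambda>x. ereal (f x)) \<le> Lp_norm q ?d"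
    by (rule Lp_norm_mono_AE) (use f_le q0 in auto)
  then have fN: "Lp_norm q (\<lambda>x. ereal (f x)) \<le> ennreal (l powr \<beta> * A) * ?N"
    using d by (rule order_trans)
  have "ennreal (l powr \<beta> * A) * ?N < \<infinity>" using N by (simp add: ennreal_mult_less_top)
  then have "f \<in> Lp_space q"
    by (intro Lp_space_if_norm_finite le_less_trans[OF fN]) simp_all
  from max_bound[OF this] have Mf:
    "Lp_norm q (\<lambda>x. enn2ereal (HL_max f x)) \<le> ennreal (B * (l powr \<beta> * A)) * ?N"
    using mult_left_mono[OF fN, of "ennreal B"] B A by (simp add: ennreal_mult mult.assoc)
  have fi: "set_integrable lebesgue Q f"
  proof -
    have "set_integrable lebesgue Q (\<lambda>y. \<bar>m\<bar> + \<bar>b y\<bar>)"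
      by (intro set_integral_add(1) set_integrable_abs bQ absolutely_integrable_on_const) (simp add: Q_def)
    then show ?thesis
      by (rule set_integrable_bound) (auto simp: f_def set_borel_measurable_def max_def indicator_def)
  qed
  define I where "I = (LINT y:Q|lebesgue. max 0 (\<bar>m\<bar> - b y))"
  have I: "I = (LINT y:Q|lebesgue. \<bar>f y\<bar>)"
    unfolding I_def by (rule set_lebesgue_integral_cong) (auto simp: f_def)
  define F where "F = I / l ^ CARD('n)"
  have "F \<le> B * (l powr \<beta> * A)"
  proof (cases "0 < F")
    case True
    \<comment> \<open>The maximal function of \<open>f\<close> is at least the mean \<open>F\<close>
      everywhere on \<open>Q\<close>. Taking norms gives \<open>F\<close> times \<open>?N\<close> on
      the left, and \<open>?N\<close> cancels against the right side of \<open>Mf\<close>.\<close>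
    have "\<bar>ereal F * indicator Q x\<bar> \<le> \<bar>enn2ereal (HL_max f x)\<bar>" for x
    proof (cases "x \<in> Q")
      case True
      then have "ennreal F \<le> HL_max f x"
        using HL_max_ge[of l a f x] l fi by (simp add: F_def I Q_def)
      then have "enn2ereal (ennreal F) \<le> enn2ereal (HL_max f x)" by (simp add: less_eq_ennreal.rep_eq)
      then show ?thesis using True \<open>0 < F\<close> by (simp add: enn2ereal_ennreal)
    qed simp
    then have "Lp_norm q (\<lambda>x. ereal F * indicator Q x) \<le> Lp_norm q (\<lambda>x. enn2ereal (HL_max f x))"
      by (intro Lp_norm_mono_AE) (use q0 in auto)
    then have "ennreal F * ?N \<le> ennreal (B * (l powr \<beta> * A)) * ?N"
      using Mf True by (simp add: Lp_norm_cmult)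
    then have "ennreal F * ?N / ?N \<le> ennreal (B * (l powr \<beta> * A)) * ?N / ?N"
      by (rule divide_right_mono_ennreal)
    then have "ennreal F \<le> ennreal (B * (l powr \<beta> * A))"
      using N by (simp add: ennreal_mult_divide_eq)
    then show ?thesis using A B by simp
  next
    case False
    moreover have "0 \<le> B * (l powr \<beta> * A)" using A B by simp
    ultimately show ?thesis by linarith
  qed
  then have "I \<le> B * (l powr \<beta> * A) * l ^ CARD('n)"
    using l by (simp add: F_def pos_divide_le_eq)
  then show ?thesis by (simp add: I_def m_def Q_def mult_ac)
qed

text \<open>The mean excess feeds both conclusions. Twice its bound controls the mean oscillation,
  whence \<open>2 * B\<close> in \<open>D\<close>; the remaining factor is the constant of
  \<open>holder_of_mean_oscillation\<close>. The excess also dominates the negative part of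
  \<open>b\<close>.\<close>

lemma sharp_space_imp_lipschitz:
  fixes b q :: "real^'n \<Rightarrow> real" and \<beta> B :: real
  defines "M \<equiv> 2 ^ CARD('n)"
  defines "D \<equiv> 2 * (M / (1 - 2 powr (- \<beta>)) + M * 2 powr \<beta>) * (2 * B)"
  assumes \<beta>: "0 < \<beta>" and q: "\<And>x. 1 \<le> q x"
    and max_bound: "\<And>f. f \<in> Lp_space q \<Longrightarrow>
      Lp_norm q (\<lambda>x. enn2ereal (HL_max f x)) \<le> ennreal B * Lp_norm q (\<lambda>x. ereal (f x))"
    and b: "b \<in> L1_loc" and A: "0 \<le> A" "sharp_norm \<beta> q b \<le> ennreal A" and B: "0 \<le> B"
  shows "lipschitz_const \<beta> b (D * A)" "AE x in lebesgue. 0 \<le> b x"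
proof -
  have meas[measurable]: "b \<in> borel_measurable lebesgue" using b by (simp add: L1_loc_def)
  note int = L1_loc_cube[OF b]
  have excess: "(LINT y:cube a l|lebesgue. max 0 (\<bar>mean (cube a l) b\<bar> - b y)) \<le> B * A * l powr \<beta> * l ^ CARD('n)"
    if "0 < l" for a l
    by (rule integral_mean_excess_le[OF q _ b A B that]) (rule max_bound)
  have excess_int: "set_integrable lebesgue (cube a l) (\<lambda>y. max 0 (c - b y))" for a l c
  proof (rule set_integrable_bound)
    show "set_integrable lebesgue (cube a l) (\<lambda>y. c - b y)"
      by (intro set_integral_diff(1) int absolutely_integrable_on_const) simp
  qed (auto simp: set_borel_measurable_def intro!: borel_measurable_times borel_measurable_max
      borel_measurable_diff meas borel_measurable_indicator)
  have "lipschitz_const \<beta> b (2 * (M / (1 - 2 powr (- \<beta>)) + M * 2 powr \<beta>) * (2 * (B * A)))"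
    unfolding M_def
  proof (rule holder_of_mean_oscillation[OF \<beta> meas int])
    fix a :: "real^'n" and l :: real assume l: "0 < l"
    let ?Q = "cube a l"
    define m where "m = mean ?Q b"
    have dint: "set_integrable lebesgue ?Q (\<lambda>y. b y - m)"
      by (intro set_integral_diff(1) int absolutely_integrable_on_const) simp
    have Im: "(LINT y:?Q|lebesgue. c) = c * l ^ CARD('n)" for c :: real
      using l by (simp add: set_integral_const measure_cube emeasure_cube)
    have "(LINT y:?Q|lebesgue. b y - m) = 0"
      using l absolutely_integrable_on_const[of ?Q m]
      by (subst set_integral_diff(2)) (auto simp: int Im m_def mean_def measure_cube)
    \<comment> \<open>A modulus is the number itself plus twice its negative part, and here the
      number has integral 0.\<close>
    moreover have "(LINT y:?Q|lebesgue. \<bar>b y - m\<bar>) = (LINT y:?Q|lebesgue. (b y - m) + 2 * max 0 (m - b y))"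
      by (rule set_lebesgue_integral_cong) (auto simp: max_def)
    moreover have "\<dots> = (LINT y:?Q|lebesgue. b y - m) + 2 * (LINT y:?Q|lebesgue. max 0 (m - b y))"
      using dint excess_int by (subst set_integral_add(2)) auto
    moreover have "(LINT y:?Q|lebesgue. max 0 (m - b y)) \<le> (LINT y:?Q|lebesgue. max 0 (\<bar>m\<bar> - b y))"
      by (rule set_integral_mono[OF excess_int excess_int]) auto
    ultimately show "(LINT y:?Q|lebesgue. \<bar>b y - mean ?Q b\<bar>) \<le> 2 * (B * A) * l powr \<beta> * l ^ CARD('n)"
      using excess[OF l, of a] by (simp add: m_def)
  qed
  then show "lipschitz_const \<beta> b (D * A)" by (simp add: D_def mult_ac)
  have "AE x in lebesgue. ennreal (max 0 (- b x)) = 0"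
  proof (rule AE_zero_if_small_on_cubes[OF _ \<beta>, of _ "B * A"])
    fix a :: "real^'n" and l :: real assume l: "0 < l"
    let ?Q = "cube a l"
    have e0: "set_integrable lebesgue ?Q (\<lambda>y. max 0 (- b y))" using excess_int[of a l 0] by simp
    have "(\<integral>\<^sup>+x\<in>?Q. ennreal (max 0 (- b x)) \<partial>lebesgue)
        = (\<integral>\<^sup>+x. ennreal (indicator ?Q x *\<^sub>R max 0 (- b x)) \<partial>lebesgue)"
      by (intro nn_integral_cong) (auto simp: indicator_def)
    also have "\<dots> = ennreal (LINT x:?Q|lebesgue. max 0 (- b x))"
      using e0 unfolding set_integrable_def set_lebesgue_integral_def
      by (intro nn_integral_eq_integral) auto
    also have "(LINT x:?Q|lebesgue. max 0 (- b x)) \<le> (LINT x:?Q|lebesgue. max 0 (\<bar>mean ?Q b\<bar> - b x))"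
      by (rule set_integral_mono[OF e0 excess_int]) auto
    also have "\<dots> \<le> B * A * l powr \<beta> * l ^ CARD('n)" by (rule excess[OF l])
    finally show "(\<integral>\<^sup>+x\<in>?Q. ennreal (max 0 (- b x)) \<partial>lebesgue) \<le> ennreal (B * A * l powr \<beta> * l ^ CARD('n))"
      by (simp add: ennreal_leI)
  qed (use A B in auto)
  then show "AE x in lebesgue. 0 \<le> b x"
    by eventually_elim (simp add: max_def split: if_splits)
qed

section \<open>Equality of the spaces and equivalence of the norms\<close>

theorem theorem1p6:
  fixes \<beta> :: real
  assumes "0 < \<beta>" and "\<beta> < 1"
  shows "\<forall>q \<in> (exponents_B :: (real^'n \<Rightarrow> real) set).
    Lip_plus \<beta> = sharp_space \<beta> q \<and>
    (\<exists>C1 C2 :: real. C1 > 0 \<and> C2 > 0 \<and>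
      (\<forall>b \<in> Lip_plus \<beta>.
         ennreal (C1 * Lip_norm \<beta> b) \<le> sharp_norm \<beta> q b \<and>
         sharp_norm \<beta> q b \<le> ennreal (C2 * Lip_norm \<beta> b)))"
proof
  fix q :: "real^'n \<Rightarrow> real" assume "q \<in> exponents_B"
  then have q: "1 \<le> q x" for x by (auto simp: exponents_B_def exponents_P_def)
  obtain B0 :: real where B0: "\<And>f. f \<in> Lp_space q \<Longrightarrow>
      Lp_norm q (\<lambda>x. enn2ereal (HL_max f x)) \<le> ennreal B0 * Lp_norm q (\<lambda>x. ereal (f x))"
    using \<open>q \<in> exponents_B\<close> by (auto simp: exponents_B_def)
  \<comment> \<open>The operator bound is made positive so that \<open>D\<close>, whose reciprocal
    serves as \<open>C1\<close>, is positive.\<close>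
  define B where "B = max 1 B0"
  have B: "0 < B" "0 \<le> B" by (auto simp: B_def)
  have max_bound: "Lp_norm q (\<lambda>x. enn2ereal (HL_max f x)) \<le> ennreal B * Lp_norm q (\<lambda>x. ereal (f x))"
    if "f \<in> Lp_space q" for f
    by (rule order_trans[OF B0[OF that]]) (auto simp: B_def intro!: mult_right_mono ennreal_leI)
  define M where "M = (2::real) ^ CARD('n)"
  define D where "D = 2 * (M / (1 - 2 powr (- \<beta>)) + M * 2 powr \<beta>) * (2 * B)"
  have "2 powr (- \<beta>) < 1" using assms by (simp add: powr_less_one)
  then have D: "0 < D" using B by (simp add: D_def M_def add_pos_pos)
  define E where "E = 4 * real CARD('n) powr \<beta>"
  have E: "0 < E" by (simp add: E_def)
  note lip = sharp_space_imp_lipschitz[OF assms(1) q max_bound _ _ _ B(2), folded M_def, folded D_def]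
  have bdd: "bdd_below {C. lipschitz_const \<beta> b C}" for b :: "real^'n \<Rightarrow> real"
    by (rule bdd_belowI[of _ 0]) (auto dest: lipschitz_const_nonneg)
  have L1: "b \<in> L1_loc" if "b \<in> Lip_plus \<beta>" for b :: "real^'n \<Rightarrow> real"
    using that Lip_subset_L1_loc[OF assms(1)] by (auto simp: Lip_plus_def)
  have upper: "sharp_norm \<beta> q b \<le> ennreal (E * C)"
    if b: "b \<in> Lip_plus \<beta>" and C: "0 < C" "lipschitz_const \<beta> b C" for b C
    unfolding E_def using b
    by (intro sharp_norm_le[OF assms(1) q L1[OF b] _ C]) (auto simp: Lip_plus_def)
  \<comment> \<open>A Lipschitz constant may be 0, for constant functions, whereas
    \<open>upper\<close> asks for a positive one; constants are therefore enlarged slightly before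
    it is applied.\<close>
  have mono: "lipschitz_const \<beta> b C'" if "lipschitz_const \<beta> b C" "C \<le> C'"
    for b :: "real^'n \<Rightarrow> real" and C C'
  proof -
    obtain g where g: "AE x in lebesgue. b x = g x"
      "\<And>x y. \<bar>g x - g y\<bar> \<le> C * norm (x - y) powr \<beta>"
      using \<open>lipschitz_const \<beta> b C\<close> by (auto simp: lipschitz_const_def)
    have "\<bar>g x - g y\<bar> \<le> C' * norm (x - y) powr \<beta>" for x y
      by (rule order_trans[OF g(2) mult_right_mono[OF \<open>C \<le> C'\<close>]]) simp
    with g(1) show ?thesis unfolding lipschitz_const_def by blast
  qed
  have finite: "sharp_norm \<beta> q b < \<infinity>" if b: "b \<in> Lip_plus \<beta>" for b
  proof -
    obtain C where C: "lipschitz_const \<beta> b C" using b by (auto simp: Lip_plus_def Lip_def)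
    have "sharp_norm \<beta> q b \<le> ennreal (E * (C + 1))"
      by (rule upper[OF b _ mono[OF C]]) (use lipschitz_const_nonneg[OF C] in auto)
    then show ?thesis using le_less_trans by fastforce
  qed
  show "Lip_plus \<beta> = sharp_space \<beta> q \<and>
    (\<exists>C1 C2 :: real. C1 > 0 \<and> C2 > 0 \<and>
      (\<forall>b \<in> Lip_plus \<beta>.
         ennreal (C1 * Lip_norm \<beta> b) \<le> sharp_norm \<beta> q b \<and>
         sharp_norm \<beta> q b \<le> ennreal (C2 * Lip_norm \<beta> b)))"
  proof (intro conjI exI ballI)
    show "Lip_plus \<beta> = sharp_space \<beta> q"
    proof (intro antisym subsetI)
      fix b :: "real^'n \<Rightarrow> real" assume "b \<in> Lip_plus \<beta>"
      then show "b \<in> sharp_space \<beta> q" using L1 finite by (simp add: sharp_space_def)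
    next
      fix b :: "real^'n \<Rightarrow> real" assume b: "b \<in> sharp_space \<beta> q"
      then obtain A where "0 \<le> A" "sharp_norm \<beta> q b = ennreal A"
        by (cases "sharp_norm \<beta> q b") (auto simp: sharp_space_def)
      then show "b \<in> Lip_plus \<beta>"
        using lip[of b A] b by (auto simp: sharp_space_def Lip_plus_def Lip_def)
    qed
    show "1 / D > 0" "E > 0" using D E by auto
    fix b :: "real^'n \<Rightarrow> real" assume b: "b \<in> Lip_plus \<beta>"
    obtain A where A: "0 \<le> A" "sharp_norm \<beta> q b = ennreal A"
      using finite[OF b] by (cases "sharp_norm \<beta> q b") auto
    have "lipschitz_const \<beta> b (D * A)" by (rule lip) (use A L1[OF b] in auto)
    then have "Lip_norm \<beta> b \<le> D * A"
      unfolding Lip_norm_def by (intro cInf_lower bdd) simp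
    then show "ennreal (1 / D * Lip_norm \<beta> b) \<le> sharp_norm \<beta> q b"
      unfolding A using D by (intro ennreal_leI) (simp add: field_simps)
    \<comment> \<open>Bounding every Lipschitz constant from below carries the estimate over to
      their infimum, without deciding whether it is attained.\<close>
    have "A / E \<le> C" if C: "lipschitz_const \<beta> b C" for C
    proof (rule field_le_epsilon)
      fix e :: real assume "0 < e"
      then have "0 < C + e" using lipschitz_const_nonneg[OF C] by simp
      moreover from this have "sharp_norm \<beta> q b \<le> ennreal (E * (C + e))"
        by (rule upper[OF b _ mono[OF C]]) (use \<open>0 < e\<close> in auto)
      ultimately have "A \<le> E * (C + e)" unfolding A using E by simp
      then show "A / E \<le> C + e" using E by (simp add: field_simps)
    qed
    then have "A / E \<le> Lip_norm \<beta> b"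
      unfolding Lip_norm_def using b by (intro cInf_greatest) (auto simp: Lip_plus_def Lip_def)
    then show "sharp_norm \<beta> q b \<le> ennreal (E * Lip_norm \<beta> b)"
      unfolding A using E by (intro ennreal_leI) (simp add: field_simps)
  qed
qed

end
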